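(* Let $\Bbbk$ be a field, let $Q$ be an affine semigroup, let $\Phi$ be a face of $Q$, and let $I\subseteq\Bbbk[Q]$ be a binomial ideal. If the prime ideal $\mathfrak p_\Phi$ is minimal over $I$, then the $\mathfrak p_\Phi$-primary component of $I$ is $$(I:\mathbf t^\Phi)+\Bbbk\{U\},$$ where $U\subseteq Q$ is the unbounded ideal for the congruence $\sim_{I[\mathbb Z\Phi]}$ on $Q+\mathbb Z\Phi$. Furthermore, the only monomials in $(I:\mathbf t^\Phi)+\Bbbk\{U\}$ are those of the form $\mathbf t^u$ for $u\in U$.
   Context: The field $\Bbbk$ is arbitrary (not assumed algebraically closed or of characteristic zero). An affine semigroup is a finitely generated submonoid $Q\subseteq\mathbb Z^\ell$ of a free abelian group. A face $\Phi$ of $Q$ is a submonoid such that, for $u,v\in Q$, $u+v\in\Phi$ implies $u,v\in\Phi$. $\mathbb Z\Phi$ is the subgroup of $\mathbb Z^\ell$ generated by $\Phi$, and $Q+\mathbb Z\Phi\subseteq\mathbb Z^\ell$ is the localization of $Q$ along $\Phi$. The semigroup algebra $\Bbbk[Q]$ has $\Bbbk$-basis $\{\mathbf t^u\mid u\in Q\}$ (the monomials) with multiplication $\mathbf t^u\mathbf t^v=\mathbf t^{u+v}$. A binomial ideal is an ideal generated by elements of the form $\mathbf t^u-\lambda\mathbf t^v$ with $\lambda\in\Bbbk$ (possibly $\lambda=0$). The prime ideal of the face $\Phi$ is $\mathfrak p_\Phi=\mathrm{span}_\Bbbk\{\mathbf t^u\mid u\in Q\smallsetminus\Phi\}\subseteq\Bbbk[Q]$.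 $I[\mathbb Z\Phi]=I\,\Bbbk[Q+\mathbb Z\Phi]$ is the extension of $I$ to $\Bbbk[Q+\mathbb Z\Phi]$, and $(I:\mathbf t^\Phi)=I[\mathbb Z\Phi]\cap\Bbbk[Q]$. The congruence $\sim_{I[\mathbb Z\Phi]}$ on $Q+\mathbb Z\Phi$ is defined by: $u\sim v$ if $\mathbf t^u-\lambda\mathbf t^v\in I[\mathbb Z\Phi]$ for some nonzero scalar $\lambda\in\Bbbk$. The unbounded ideal $U\subseteq Q$ is the set of all $u\in Q$ whose congruence class in $Q+\mathbb Z\Phi$ under $\sim_{I[\mathbb Z\Phi]}$ is infinite; it satisfies $Q+U\subseteq U$. For a subset $S\subseteq Q$ with $Q+S\subseteq S$, $\Bbbk\{S\}=\mathrm{span}_\Bbbk\{\mathbf t^u\mid u\in S\}$ denotes the corresponding monomial ideal. For a prime $\mathfrak p$ minimal over $I$, the $\mathfrak p$-primary component of $I$ is the kernel of the localization map $\Bbbk[Q]\to(\Bbbk[Q]/I)_{\mathfrak p}$. *)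

theory Defs
  imports
    "HOL-Library.Poly_Mapping"
    "HOL-Library.Set_Algebras"
    "HOL-Computational_Algebra.Group_Closure"
    "HOL-Analysis.Finite_Cartesian_Product"
    "HOL-Algebra.QuotRing"
begin

section \<open>Affine semigroups and faces\<close>

definition additive_submonoid :: "'a::monoid_add set \<Rightarrow> bool" where
  "additive_submonoid M \<longleftrightarrow> 0 \<in> M \<and> (\<forall>u\<in>M. \<forall>v\<in>M. u + v \<in> M)"

definition affine_semigroup :: "(int ^ 'l) set \<Rightarrow> bool" where
  "affine_semigroup Q \<longleftrightarrow> (\<exists>A. finite A \<and> Q = additive_submonoid hull A)"

definition semigroup_face :: "'a::monoid_add set \<Rightarrow> 'a set \<Rightarrow> bool" where
  "semigroup_face F Q \<longleftrightarrow>
     F \<subseteq> Q \<and> additive_submonoid F \<and> (\<forall>u\<in>Q. \<forall>v\<in>Q. u + v \<in> F \<longrightarrow> u \<in> F \<and> v \<in> F)"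

text \<open>\<open>Q + \<int>F\<close>; the sum is the elementwise sum of sets.\<close>

definition localize_along :: "'a::ab_group_add set \<Rightarrow> 'a set \<Rightarrow> 'a set" where
  "localize_along Q F = Q + group_closure F"

section \<open>Semigroup algebras\<close>

text \<open>
  All semigroup algebras live inside the group algebra \<open>(int ^ 'l) \<Rightarrow>\<^sub>0 'k\<close>, whose product is
  convolution; an inclusion of semigroups thus induces a literal inclusion of algebras.
\<close>

abbreviation tmon :: "'a \<Rightarrow> 'a \<Rightarrow>\<^sub>0 'k::zero_neq_one" where
  "tmon u \<equiv> Poly_Mapping.single u 1"

definition scal :: "'k \<Rightarrow> ('a \<Rightarrow>\<^sub>0 'k) \<Rightarrow> ('a::monoid_add \<Rightarrow>\<^sub>0 'k::semiring_0)" where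
  "scal c f = Poly_Mapping.single 0 c * f"

definition monomial_span :: "'a set \<Rightarrow> ('a::comm_monoid_add \<Rightarrow>\<^sub>0 'k::field) set" where
  "monomial_span S = module.span scal (tmon ` S)"

definition semigroup_algebra :: "'a::comm_monoid_add set \<Rightarrow> ('a \<Rightarrow>\<^sub>0 'k::field) ring" where
  "semigroup_algebra Q =
     \<lparr>carrier = monomial_span Q, mult = (*), one = 1, zero = 0, add = (+)\<rparr>"

definition binomial_ideal :: "'a::comm_monoid_add set \<Rightarrow> ('a \<Rightarrow>\<^sub>0 'k::field) set \<Rightarrow> bool" where
  "binomial_ideal Q I \<longleftrightarrow>
     (\<exists>B. B \<subseteq> {tmon u - scal c (tmon v) | u v c. u \<in> Q \<and> v \<in> Q}
        \<and> I = Idl\<^bsub>semigroup_algebra Q\<^esub> B)"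

definition face_ideal :: "'a::comm_monoid_add set \<Rightarrow> 'a set \<Rightarrow> ('a \<Rightarrow>\<^sub>0 'k::field) set" where
  "face_ideal Q F = monomial_span (Q - F)"

definition ext_ideal ::
    "'a::ab_group_add set \<Rightarrow> 'a set \<Rightarrow> ('a \<Rightarrow>\<^sub>0 'k::field) set \<Rightarrow> ('a \<Rightarrow>\<^sub>0 'k) set" where
  "ext_ideal Q F I = Idl\<^bsub>semigroup_algebra (localize_along Q F)\<^esub> I"

definition colon_face ::
    "'a::ab_group_add set \<Rightarrow> 'a set \<Rightarrow> ('a \<Rightarrow>\<^sub>0 'k::field) set \<Rightarrow> ('a \<Rightarrow>\<^sub>0 'k) set" where
  "colon_face Q F I = ext_ideal Q F I \<inter> carrier (semigroup_algebra Q)"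

definition face_congruence ::
    "'a::ab_group_add set \<Rightarrow> 'a set \<Rightarrow> ('a \<Rightarrow>\<^sub>0 'k::field) set \<Rightarrow> ('a \<times> 'a) set" where
  "face_congruence Q F I =
     {(u, v). u \<in> localize_along Q F \<and> v \<in> localize_along Q F
        \<and> (\<exists>c. c \<noteq> 0 \<and> tmon u - scal c (tmon v) \<in> ext_ideal Q F I)}"

definition unbounded_ideal ::
    "'a::ab_group_add set \<Rightarrow> 'a set \<Rightarrow> ('a \<Rightarrow>\<^sub>0 'k::field) set \<Rightarrow> 'a set" where
  "unbounded_ideal Q F I = {u \<in> Q. infinite (face_congruence Q F I `` {u})}"

section \<open>Minimal primes, localization, and primary components\<close>

definition minimal_prime_over :: "('r, 'm) ring_scheme \<Rightarrow> 'r set \<Rightarrow> 'r set \<Rightarrow> bool" where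
  "minimal_prime_over R I P \<longleftrightarrow>
     primeideal P R \<and> I \<subseteq> P \<and> (\<forall>P'. primeideal P' R \<and> I \<subseteq> P' \<and> P' \<subseteq> P \<longrightarrow> P' = P)"

text \<open>
  The localization \<open>S\<^sup>-\<^sup>1A\<close> of a commutative ring at a multiplicative subset, as classes of
  pairs (numerator, denominator).
\<close>

definition frac_rel :: "('r, 'm) ring_scheme \<Rightarrow> 'r set \<Rightarrow> (('r \<times> 'r) \<times> ('r \<times> 'r)) set" where
  "frac_rel A S =
     {((a, s), (b, t)). a \<in> carrier A \<and> s \<in> S \<and> b \<in> carrier A \<and> t \<in> S \<and>
        (\<exists>w\<in>S. w \<otimes>\<^bsub>A\<^esub> (t \<otimes>\<^bsub>A\<^esub> a) = w \<otimes>\<^bsub>A\<^esub> (s \<otimes>\<^bsub>A\<^esub> b))}"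

definition fraction :: "('r, 'm) ring_scheme \<Rightarrow> 'r set \<Rightarrow> 'r \<Rightarrow> 'r \<Rightarrow> ('r \<times> 'r) set" where
  "fraction A S a s = frac_rel A S `` {(a, s)}"

definition localization :: "('r, 'm) ring_scheme \<Rightarrow> 'r set \<Rightarrow> ('r \<times> 'r) set ring" where
  "localization A S =
     \<lparr>carrier = (carrier A \<times> S) // frac_rel A S,
      mult = (\<lambda>X Y. \<Union>(a, s)\<in>X. \<Union>(b, t)\<in>Y. fraction A S (a \<otimes>\<^bsub>A\<^esub> b) (s \<otimes>\<^bsub>A\<^esub> t)),
      one = fraction A S \<one>\<^bsub>A\<^esub> \<one>\<^bsub>A\<^esub>,
      zero = fraction A S \<zero>\<^bsub>A\<^esub> \<one>\<^bsub>A\<^esub>,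
      add = (\<lambda>X Y. \<Union>(a, s)\<in>X. \<Union>(b, t)\<in>Y.
               fraction A S (t \<otimes>\<^bsub>A\<^esub> a \<oplus>\<^bsub>A\<^esub> s \<otimes>\<^bsub>A\<^esub> b) (s \<otimes>\<^bsub>A\<^esub> t))\<rparr>"

text \<open>
  For an ideal \<open>I\<close> inside a prime \<open>P\<close> of \<open>R\<close>, the ring \<open>(R/I)\<^sub>P\<close> inverts the residue classes of
  the elements outside \<open>P\<close>, that is, the complement of \<open>P/I\<close>.
\<close>

definition quot_local :: "('r, 'm) ring_scheme \<Rightarrow> 'r set \<Rightarrow> 'r set \<Rightarrow> ('r set \<times> 'r set) set ring" where
  "quot_local R I P = localization (R Quot I) ((\<lambda>r. I +>\<^bsub>R\<^esub> r) ` (carrier R - P))"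

definition quot_local_map ::
    "('r, 'm) ring_scheme \<Rightarrow> 'r set \<Rightarrow> 'r set \<Rightarrow> 'r \<Rightarrow> ('r set \<times> 'r set) set" where
  "quot_local_map R I P f =
     fraction (R Quot I) ((\<lambda>r. I +>\<^bsub>R\<^esub> r) ` (carrier R - P)) (I +>\<^bsub>R\<^esub> f) \<one>\<^bsub>R Quot I\<^esub>"

definition primary_component :: "('r, 'm) ring_scheme \<Rightarrow> 'r set \<Rightarrow> 'r set \<Rightarrow> 'r set" where
  "primary_component R I P = a_kernel R (quot_local R I P) (quot_local_map R I P)"

section \<open>Basic facts\<close>

lemma module_scal: "module (scal :: 'k::field \<Rightarrow> ('a::comm_monoid_add \<Rightarrow>\<^sub>0 'k) \<Rightarrow> _)"
  by unfold_locales
    (simp_all add: scal_def distrib_left distrib_right single_add mult_single flip: mult.assoc)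

lemma scal_tmon [simp]:
  "scal c (tmon u) = Poly_Mapping.single (u :: 'a::comm_monoid_add) (c :: 'k::field)"
  by (simp add: scal_def mult_single)

lemma monomial_span_eq:
  "monomial_span S = {f :: 'a::comm_monoid_add \<Rightarrow>\<^sub>0 'k::field. Poly_Mapping.keys f \<subseteq> S}"
proof -
  interpret module "scal :: 'k \<Rightarrow> ('a \<Rightarrow>\<^sub>0 'k) \<Rightarrow> _" by (rule module_scal)
  have k: "Poly_Mapping.keys (scal c f) \<subseteq> Poly_Mapping.keys f" for c :: 'k and f :: "'a \<Rightarrow>\<^sub>0 'k"
    using keys_mult[of "Poly_Mapping.single 0 c" f] by (auto simp: scal_def split: if_splits)
  have sub: "subspace {f :: 'a \<Rightarrow>\<^sub>0 'k. Poly_Mapping.keys f \<subseteq> S}"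
    unfolding subspace_def
  proof (intro conjI allI ballI)
    fix f g :: "'a \<Rightarrow>\<^sub>0 'k"
    assume "f \<in> {f. Poly_Mapping.keys f \<subseteq> S}" "g \<in> {f. Poly_Mapping.keys f \<subseteq> S}"
    then show "f + g \<in> {f. Poly_Mapping.keys f \<subseteq> S}" using keys_add[of f g] by blast
  qed (use k in auto)
  show ?thesis
  proof
    show "monomial_span S \<subseteq> {f :: 'a \<Rightarrow>\<^sub>0 'k. Poly_Mapping.keys f \<subseteq> S}"
      unfolding monomial_span_def by (rule span_minimal[OF _ sub]) auto
  next
    show "{f :: 'a \<Rightarrow>\<^sub>0 'k. Poly_Mapping.keys f \<subseteq> S} \<subseteq> monomial_span S"
    proof safe
      fix f :: "'a \<Rightarrow>\<^sub>0 'k" assume f: "Poly_Mapping.keys f \<subseteq> S"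
      have "f = (\<Sum>u\<in>Poly_Mapping.keys f. scal (Poly_Mapping.lookup f u) (tmon u))"
        by (rule poly_mapping_eqI)
          (auto simp: lookup_sum lookup_single when_def in_keys_iff sum.delta' if_distrib cong: if_cong)
      moreover have "\<dots> \<in> monomial_span S" unfolding monomial_span_def
        using f by (intro span_sum span_scale span_base) auto
      ultimately show "f \<in> monomial_span S" by simp
    qed
  qed
qed

lemma additive_submonoid_hull: "additive_submonoid (additive_submonoid hull A)"
  by (auto simp: hull_def additive_submonoid_def)

lemma cring_semigroup_algebra:
  assumes "additive_submonoid Q"
  shows "cring (semigroup_algebra Q :: ('a::comm_monoid_add \<Rightarrow>\<^sub>0 'k::field) ring)"
proof -
  have m: "Poly_Mapping.keys (f * g) \<subseteq> Q"
    if "Poly_Mapping.keys f \<subseteq> Q" "Poly_Mapping.keys g \<subseteq> Q" for f g :: "'a \<Rightarrow>\<^sub>0 'k"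
    using keys_mult[of f g] that assms unfolding additive_submonoid_def by blast
  have a: "Poly_Mapping.keys (f + g) \<subseteq> Q"
    if "Poly_Mapping.keys f \<subseteq> Q" "Poly_Mapping.keys g \<subseteq> Q" for f g :: "'a \<Rightarrow>\<^sub>0 'k"
    using keys_add[of f g] that by blast
  have neg: "Poly_Mapping.keys (- f) = Poly_Mapping.keys f" for f :: "'a \<Rightarrow>\<^sub>0 'k"
    by (auto simp: in_keys_iff)
  have o: "Poly_Mapping.keys (1 :: 'a \<Rightarrow>\<^sub>0 'k) \<subseteq> Q"
    using assms by (simp add: additive_submonoid_def)
  let ?A = "semigroup_algebra Q :: ('a \<Rightarrow>\<^sub>0 'k) ring"
  have "abelian_group ?A"
  proof (rule abelian_groupI)
    fix f assume "f \<in> carrier ?A"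
    then show "\<exists>g\<in>carrier ?A. g \<oplus>\<^bsub>?A\<^esub> f = \<zero>\<^bsub>?A\<^esub>"
      by (intro bexI[of _ "- f"]) (simp_all add: semigroup_algebra_def monomial_span_eq neg)
  qed (simp_all add: semigroup_algebra_def monomial_span_eq a add_ac)
  moreover have "Group.comm_monoid ?A"
    by (rule comm_monoidI)
      (use o in \<open>simp_all add: semigroup_algebra_def monomial_span_eq m mult_ac\<close>)
  ultimately show ?thesis
    by (rule cringI) (simp add: semigroup_algebra_def distrib_right)
qed


lemma equiv_frac_rel:
  assumes "cring A" "S \<subseteq> carrier A" "submonoid S A"
  shows "equiv (carrier A \<times> S) (frac_rel A S)"
proof -
  interpret cring A by fact
  interpret submonoid S A by fact
  note S = subsetD[OF assms(2)]
  show ?thesis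
  proof (rule equivI)
    show "frac_rel A S \<subseteq> (carrier A \<times> S) \<times> (carrier A \<times> S)" by (auto simp: frac_rel_def)
    show "refl_on (carrier A \<times> S) (frac_rel A S)"
      by (rule refl_onI) (use one_closed in \<open>auto simp: frac_rel_def\<close>)
    show "sym (frac_rel A S)" by (rule symI) (force simp: frac_rel_def)
    show "trans (frac_rel A S)"
    proof (rule transI, clarify)
      fix a s b t c r
      assume 1: "((a, s), (b, t)) \<in> frac_rel A S" and 2: "((b, t), (c, r)) \<in> frac_rel A S"
      from 1 2 have m: "a \<in> carrier A" "b \<in> carrier A" "c \<in> carrier A" "s \<in> S" "t \<in> S" "r \<in> S"
        by (auto simp: frac_rel_def)
      from 1 obtain w where w: "w \<in> S" "w \<otimes>\<^bsub>A\<^esub> (t \<otimes>\<^bsub>A\<^esub> a) = w \<otimes>\<^bsub>A\<^esub> (s \<otimes>\<^bsub>A\<^esub> b)" by (auto simp: frac_rel_def)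
      from 2 obtain z where z: "z \<in> S" "z \<otimes>\<^bsub>A\<^esub> (r \<otimes>\<^bsub>A\<^esub> b) = z \<otimes>\<^bsub>A\<^esub> (t \<otimes>\<^bsub>A\<^esub> c)" by (auto simp: frac_rel_def)
      note mm = m w(1) z(1) S[OF m(4)] S[OF m(5)] S[OF m(6)] S[OF w(1)] S[OF z(1)]
      have "(w \<otimes>\<^bsub>A\<^esub> z \<otimes>\<^bsub>A\<^esub> t) \<otimes>\<^bsub>A\<^esub> (r \<otimes>\<^bsub>A\<^esub> a) = z \<otimes>\<^bsub>A\<^esub> r \<otimes>\<^bsub>A\<^esub> (w \<otimes>\<^bsub>A\<^esub> (t \<otimes>\<^bsub>A\<^esub> a))"
        using mm by (simp add: m_ac)
      also have "\<dots> = w \<otimes>\<^bsub>A\<^esub> s \<otimes>\<^bsub>A\<^esub> (z \<otimes>\<^bsub>A\<^esub> (r \<otimes>\<^bsub>A\<^esub> b))"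
        unfolding w(2) using mm by (simp add: m_ac)
      also have "\<dots> = (w \<otimes>\<^bsub>A\<^esub> z \<otimes>\<^bsub>A\<^esub> t) \<otimes>\<^bsub>A\<^esub> (s \<otimes>\<^bsub>A\<^esub> c)"
        unfolding z(2) using mm by (simp add: m_ac)
      finally show "((a, s), (c, r)) \<in> frac_rel A S"
        using mm m_closed by (auto simp: frac_rel_def)
    qed
  qed
qed


lemma frac_eq_iff:
  assumes "cring A" "S \<subseteq> carrier A" "submonoid S A"
    and "a \<in> carrier A" "s \<in> S" "b \<in> carrier A" "t \<in> S"
  shows "fraction A S a s = fraction A S b t \<longleftrightarrow>
    (\<exists>w\<in>S. w \<otimes>\<^bsub>A\<^esub> (t \<otimes>\<^bsub>A\<^esub> a) = w \<otimes>\<^bsub>A\<^esub> (s \<otimes>\<^bsub>A\<^esub> b))"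
  unfolding fraction_def
  using eq_equiv_class_iff[OF equiv_frac_rel[OF assms(1-3)], of "(a, s)" "(b, t)"] assms(4-)
  by (auto simp: frac_rel_def)

lemma localization_mult:
  assumes A: "cring A" "S \<subseteq> carrier A" "submonoid S A"
    and m: "a \<in> carrier A" "s \<in> S" "b \<in> carrier A" "t \<in> S"
  shows "fraction A S a s \<otimes>\<^bsub>localization A S\<^esub> fraction A S b t = fraction A S (a \<otimes>\<^bsub>A\<^esub> b) (s \<otimes>\<^bsub>A\<^esub> t)"
proof -
  interpret cring A by fact
  interpret submonoid S A by fact
  note S = subsetD[OF A(2)]
  have *: "fraction A S (a' \<otimes>\<^bsub>A\<^esub> b') (s' \<otimes>\<^bsub>A\<^esub> t') = fraction A S (a \<otimes>\<^bsub>A\<^esub> b) (s \<otimes>\<^bsub>A\<^esub> t)"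
    if h: "(a', s') \<in> fraction A S a s" "(b', t') \<in> fraction A S b t" for a' s' b' t'
  proof -
    from h have m': "a' \<in> carrier A" "s' \<in> S" "b' \<in> carrier A" "t' \<in> S"
      by (auto simp: fraction_def frac_rel_def)
    from h(1) obtain w where w: "w \<in> S" "w \<otimes>\<^bsub>A\<^esub> (s' \<otimes>\<^bsub>A\<^esub> a) = w \<otimes>\<^bsub>A\<^esub> (s \<otimes>\<^bsub>A\<^esub> a')"
      by (auto simp: fraction_def frac_rel_def)
    from h(2) obtain z where z: "z \<in> S" "z \<otimes>\<^bsub>A\<^esub> (t' \<otimes>\<^bsub>A\<^esub> b) = z \<otimes>\<^bsub>A\<^esub> (t \<otimes>\<^bsub>A\<^esub> b')"
      by (auto simp: fraction_def frac_rel_def)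
    note c = m m' w(1) z(1) S[OF m(2)] S[OF m(4)] S[OF m'(2)] S[OF m'(4)] S[OF w(1)] S[OF z(1)]
    have "w \<otimes>\<^bsub>A\<^esub> z \<otimes>\<^bsub>A\<^esub> ((s \<otimes>\<^bsub>A\<^esub> t) \<otimes>\<^bsub>A\<^esub> (a' \<otimes>\<^bsub>A\<^esub> b'))
        = (w \<otimes>\<^bsub>A\<^esub> (s \<otimes>\<^bsub>A\<^esub> a')) \<otimes>\<^bsub>A\<^esub> (z \<otimes>\<^bsub>A\<^esub> (t \<otimes>\<^bsub>A\<^esub> b'))"
      using c by (simp add: m_ac)
    also have "\<dots> = w \<otimes>\<^bsub>A\<^esub> z \<otimes>\<^bsub>A\<^esub> ((s' \<otimes>\<^bsub>A\<^esub> t') \<otimes>\<^bsub>A\<^esub> (a \<otimes>\<^bsub>A\<^esub> b))"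
      unfolding w(2)[symmetric] z(2)[symmetric] using c by (simp add: m_ac)
    finally have e: "w \<otimes>\<^bsub>A\<^esub> z \<otimes>\<^bsub>A\<^esub> ((s \<otimes>\<^bsub>A\<^esub> t) \<otimes>\<^bsub>A\<^esub> (a' \<otimes>\<^bsub>A\<^esub> b'))
        = w \<otimes>\<^bsub>A\<^esub> z \<otimes>\<^bsub>A\<^esub> ((s' \<otimes>\<^bsub>A\<^esub> t') \<otimes>\<^bsub>A\<^esub> (a \<otimes>\<^bsub>A\<^esub> b))" .
    have "w \<otimes>\<^bsub>A\<^esub> z \<in> S" using c by simp
    then show ?thesis
      by (intro iffD2[OF frac_eq_iff[OF A]] bexI[of _ "w \<otimes>\<^bsub>A\<^esub> z"]) (use c e in \<open>assumption | simp\<close>)+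
  qed
  have ne: "(a, s) \<in> fraction A S a s" "(b, t) \<in> fraction A S b t"
    using equiv_class_self[OF equiv_frac_rel[OF A]] m unfolding fraction_def by auto
  show ?thesis
    using ne by (auto simp: localization_def split: prod.split intro!: SUP_eq_const *)
qed

lemma localization_add:
  assumes A: "cring A" "S \<subseteq> carrier A" "submonoid S A"
    and m: "a \<in> carrier A" "s \<in> S" "b \<in> carrier A" "t \<in> S"
  shows "fraction A S a s \<oplus>\<^bsub>localization A S\<^esub> fraction A S b t
    = fraction A S (t \<otimes>\<^bsub>A\<^esub> a \<oplus>\<^bsub>A\<^esub> s \<otimes>\<^bsub>A\<^esub> b) (s \<otimes>\<^bsub>A\<^esub> t)"
proof -
  interpret cring A by fact
  interpret submonoid S A by fact
  note S = subsetD[OF A(2)]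
  have *: "fraction A S (t' \<otimes>\<^bsub>A\<^esub> a' \<oplus>\<^bsub>A\<^esub> s' \<otimes>\<^bsub>A\<^esub> b') (s' \<otimes>\<^bsub>A\<^esub> t')
      = fraction A S (t \<otimes>\<^bsub>A\<^esub> a \<oplus>\<^bsub>A\<^esub> s \<otimes>\<^bsub>A\<^esub> b) (s \<otimes>\<^bsub>A\<^esub> t)"
    if h: "(a', s') \<in> fraction A S a s" "(b', t') \<in> fraction A S b t" for a' s' b' t'
  proof -
    from h have m': "a' \<in> carrier A" "s' \<in> S" "b' \<in> carrier A" "t' \<in> S"
      by (auto simp: fraction_def frac_rel_def)
    from h(1) obtain w where w: "w \<in> S" "w \<otimes>\<^bsub>A\<^esub> (s' \<otimes>\<^bsub>A\<^esub> a) = w \<otimes>\<^bsub>A\<^esub> (s \<otimes>\<^bsub>A\<^esub> a')"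
      by (auto simp: fraction_def frac_rel_def)
    from h(2) obtain z where z: "z \<in> S" "z \<otimes>\<^bsub>A\<^esub> (t' \<otimes>\<^bsub>A\<^esub> b) = z \<otimes>\<^bsub>A\<^esub> (t \<otimes>\<^bsub>A\<^esub> b')"
      by (auto simp: fraction_def frac_rel_def)
    note c = m m' w(1) z(1) S[OF m(2)] S[OF m(4)] S[OF m'(2)] S[OF m'(4)] S[OF w(1)] S[OF z(1)]
    have "w \<otimes>\<^bsub>A\<^esub> z \<otimes>\<^bsub>A\<^esub> ((s \<otimes>\<^bsub>A\<^esub> t) \<otimes>\<^bsub>A\<^esub> (t' \<otimes>\<^bsub>A\<^esub> a' \<oplus>\<^bsub>A\<^esub> s' \<otimes>\<^bsub>A\<^esub> b'))
        = z \<otimes>\<^bsub>A\<^esub> t \<otimes>\<^bsub>A\<^esub> t' \<otimes>\<^bsub>A\<^esub> (w \<otimes>\<^bsub>A\<^esub> (s \<otimes>\<^bsub>A\<^esub> a')) \<oplus>\<^bsub>A\<^esub> w \<otimes>\<^bsub>A\<^esub> s \<otimes>\<^bsub>A\<^esub> s' \<otimes>\<^bsub>A\<^esub> (z \<otimes>\<^bsub>A\<^esub> (t \<otimes>\<^bsub>A\<^esub> b'))"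
      using c by (simp add: r_distr m_ac)
    also have "\<dots> = w \<otimes>\<^bsub>A\<^esub> z \<otimes>\<^bsub>A\<^esub> ((s' \<otimes>\<^bsub>A\<^esub> t') \<otimes>\<^bsub>A\<^esub> (t \<otimes>\<^bsub>A\<^esub> a \<oplus>\<^bsub>A\<^esub> s \<otimes>\<^bsub>A\<^esub> b))"
      unfolding w(2)[symmetric] z(2)[symmetric] using c by (simp add: r_distr m_ac)
    finally have e: "w \<otimes>\<^bsub>A\<^esub> z \<otimes>\<^bsub>A\<^esub> ((s \<otimes>\<^bsub>A\<^esub> t) \<otimes>\<^bsub>A\<^esub> (t' \<otimes>\<^bsub>A\<^esub> a' \<oplus>\<^bsub>A\<^esub> s' \<otimes>\<^bsub>A\<^esub> b'))
        = w \<otimes>\<^bsub>A\<^esub> z \<otimes>\<^bsub>A\<^esub> ((s' \<otimes>\<^bsub>A\<^esub> t') \<otimes>\<^bsub>A\<^esub> (t \<otimes>\<^bsub>A\<^esub> a \<oplus>\<^bsub>A\<^esub> s \<otimes>\<^bsub>A\<^esub> b))" .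
    have "w \<otimes>\<^bsub>A\<^esub> z \<in> S" using c by simp
    then show ?thesis
      by (intro iffD2[OF frac_eq_iff[OF A]] bexI[of _ "w \<otimes>\<^bsub>A\<^esub> z"]) (use c e in \<open>assumption | simp\<close>)+
  qed
  have ne: "(a, s) \<in> fraction A S a s" "(b, t) \<in> fraction A S b t"
    using equiv_class_self[OF equiv_frac_rel[OF A]] m unfolding fraction_def by auto
  show ?thesis
    using ne by (auto simp: localization_def split: prod.split intro!: SUP_eq_const *)
qed

lemma quot_complement_submonoid:
  assumes R: "cring R" and I: "ideal I R" and P: "primeideal P R" and IP: "I \<subseteq> P"
  shows "(\<lambda>r. I +>\<^bsub>R\<^esub> r) ` (carrier R - P) \<subseteq> carrier (R Quot I)" (is "?S \<subseteq> _")
    and "submonoid ((\<lambda>r. I +>\<^bsub>R\<^esub> r) ` (carrier R - P)) (R Quot I)"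
proof -
  interpret ideal I R by fact
  interpret P: primeideal P R by fact
  interpret R: cring R by fact
  show c: "?S \<subseteq> carrier (R Quot I)"
    by (auto simp: FactRing_def A_RCOSETS_def RCOSETS_def a_r_coset_def)
  show "submonoid ?S (R Quot I)"
  proof (rule submonoid.intro)
    show "\<one>\<^bsub>R Quot I\<^esub> \<in> ?S" using P.one_imp_carrier P.I_notcarr by (auto simp: FactRing_def)
    fix x y assume "x \<in> ?S" "y \<in> ?S"
    then obtain r s where "x = I +>\<^bsub>R\<^esub> r" "y = I +>\<^bsub>R\<^esub> s" "r \<in> carrier R - P" "s \<in> carrier R - P" by blast
    then show "x \<otimes>\<^bsub>R Quot I\<^esub> y \<in> ?S"
      using P.I_prime[of r s] by (auto simp: FactRing_def rcoset_mult_add)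
  qed (use c in auto)
qed

lemma primary_component_eq:
  assumes R: "cring R" and I: "ideal I R" and P: "primeideal P R" and IP: "I \<subseteq> P"
  shows "primary_component R I P = {f \<in> carrier R. \<exists>s \<in> carrier R - P. s \<otimes>\<^bsub>R\<^esub> f \<in> I}"
proof -
  note Q = ideal.quotient_is_cring[OF I R]
  let ?A = "R Quot I" and ?S = "(\<lambda>r. I +>\<^bsub>R\<^esub> r) ` (carrier R - P)"
  note S = quot_complement_submonoid[OF assms]
  have ring: "ring R" using R by (rule cring.axioms)
  have hom: "(+>\<^bsub>R\<^esub>) I \<in> ring_hom R ?A" by (rule ideal.rcos_ring_hom[OF I])
  have k: "I +>\<^bsub>R\<^esub> x = \<zero>\<^bsub>?A\<^esub> \<longleftrightarrow> x \<in> I" if "x \<in> carrier R" for x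
    using ideal.rcos_const_imp_mem[OF I, of x] ring.a_rcos_zero[OF ring I, of x] that
    by (auto simp: FactRing_def)
  have "fraction ?A ?S (I +>\<^bsub>R\<^esub> f) \<one>\<^bsub>?A\<^esub> = fraction ?A ?S \<zero>\<^bsub>?A\<^esub> \<one>\<^bsub>?A\<^esub>
      \<longleftrightarrow> (\<exists>s \<in> carrier R - P. s \<otimes>\<^bsub>R\<^esub> f \<in> I)" if f: "f \<in> carrier R" for f
  proof -
    have f': "I +>\<^bsub>R\<^esub> f \<in> carrier ?A" using ring_hom_closed[OF hom f] .
    have e: "(I +>\<^bsub>R\<^esub> s) \<otimes>\<^bsub>?A\<^esub> (\<one>\<^bsub>?A\<^esub> \<otimes>\<^bsub>?A\<^esub> (I +>\<^bsub>R\<^esub> f))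
          = (I +>\<^bsub>R\<^esub> s) \<otimes>\<^bsub>?A\<^esub> (\<one>\<^bsub>?A\<^esub> \<otimes>\<^bsub>?A\<^esub> \<zero>\<^bsub>?A\<^esub>) \<longleftrightarrow> s \<otimes>\<^bsub>R\<^esub> f \<in> I"
      if s: "s \<in> carrier R" for s
    proof -
      interpret Q: cring ?A by (rule Q)
      have "(I +>\<^bsub>R\<^esub> s) \<otimes>\<^bsub>?A\<^esub> (\<one>\<^bsub>?A\<^esub> \<otimes>\<^bsub>?A\<^esub> (I +>\<^bsub>R\<^esub> f)) = I +>\<^bsub>R\<^esub> (s \<otimes>\<^bsub>R\<^esub> f)"
        using ring_hom_mult[OF hom s f] Q.l_one[OF f'] by simp
      moreover have "(I +>\<^bsub>R\<^esub> s) \<otimes>\<^bsub>?A\<^esub> (\<one>\<^bsub>?A\<^esub> \<otimes>\<^bsub>?A\<^esub> \<zero>\<^bsub>?A\<^esub>) = \<zero>\<^bsub>?A\<^esub>"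
        using ring_hom_closed[OF hom s] Q.r_null Q.one_closed by metis
      ultimately show ?thesis
        using k[of "s \<otimes>\<^bsub>R\<^esub> f"] monoid.m_closed[OF ring.is_monoid[OF ring] s f] by metis
    qed
    have "fraction ?A ?S (I +>\<^bsub>R\<^esub> f) \<one>\<^bsub>?A\<^esub> = fraction ?A ?S \<zero>\<^bsub>?A\<^esub> \<one>\<^bsub>?A\<^esub> \<longleftrightarrow>
        (\<exists>w\<in>?S. w \<otimes>\<^bsub>?A\<^esub> (\<one>\<^bsub>?A\<^esub> \<otimes>\<^bsub>?A\<^esub> (I +>\<^bsub>R\<^esub> f)) = w \<otimes>\<^bsub>?A\<^esub> (\<one>\<^bsub>?A\<^esub> \<otimes>\<^bsub>?A\<^esub> \<zero>\<^bsub>?A\<^esub>))"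
      by (rule frac_eq_iff[OF Q S f' submonoid.one_closed[OF S(2)]
            ring.ring_simprules(2)[OF cring.axioms(1)[OF Q]] submonoid.one_closed[OF S(2)]])
    also have "\<dots> \<longleftrightarrow> (\<exists>s \<in> carrier R - P. s \<otimes>\<^bsub>R\<^esub> f \<in> I)"
      unfolding bex_simps(7) using e by (intro bex_cong refl) blast
    finally show ?thesis .
  qed
  then show ?thesis
    unfolding primary_component_def a_kernel_def kernel_def quot_local_map_def quot_local_def
    by (intro Collect_cong conj_cong) (simp_all add: localization_def)
qed

end

theory Submission
  imports Defs "HOL-Algebra.Ring_Divisibility" "HOL-Computational_Algebra.Polynomial"
begin

text \<open>
  Write \<open>L = Q + \<int>\<Phi>\<close> and \<open>J = I[\<int>\<Phi>]\<close>. The \<open>\<pp>\<^sub>\<Phi>\<close>-primary component consists of the \<open>f\<close> with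
  \<open>s f \<in> I\<close> for some \<open>s\<close> outside \<open>\<pp>\<^sub>\<Phi>\<close>, that is, for some \<open>s\<close> in which a monomial from \<open>\<Phi>\<close> occurs.
  Membership in \<open>J\<close> means \<open>t\<^sup>a f \<in> I\<close> for some \<open>a \<in> \<Phi>\<close>, so \<open>(I : t\<^sup>\<Phi>)\<close> lies in the component.

  A monomial \<open>t\<^sup>u\<close> with infinite class lies in the component as well, by minimality. Minimality
  makes every \<open>t\<^sup>a\<close> with \<open>a \<in> Q - \<Phi>\<close> nilpotent modulo \<open>I\<close> after multiplication by an
  element outside the prime (\<open>minimal_prime_power_annihilated\<close>), and one multiplier \<open>s\<close> serves for all generators of \<open>Q\<close> outside \<open>\<Phi>\<close>. The \<open>v \<in> L\<close> with \<open>s t\<^sup>v \<notin> J\<close> then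
  lie in finitely many cosets of \<open>\<int>\<Phi>\<close> (\<open>finite_cosets_outside_ideal\<close>). So the class of \<open>u\<close> either
  contains some \<open>v\<close> with \<open>s t\<^sup>v \<in> J\<close>, or it contains two points of one coset; in the second case
  \<open>t\<^sup>u\<close> is killed modulo \<open>J\<close> by \<open>1 - d t\<^sup>z\<close> with \<open>0 \<noteq> z \<in> \<int>\<Phi>\<close>, which becomes an element of
  \<open>\<Bbbk>[\<Phi>]\<close> after clearing denominators.

  For the converse, let \<open>f\<close> lie in the component and let \<open>h\<close> be the part of \<open>f\<close> carried by the finite
  classes. Then \<open>s h\<close> lies in \<open>J\<close> up to monomials with infinite class, and \<open>cancel_unit_key\<close> shows
  that \<open>h \<in> J\<close>. Three facts carry its proof. As \<open>J\<close> is binomial, restricting an element of \<open>J\<close> to a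
  union of classes stays in \<open>J\<close> (\<open>restrict_keys_in_ideal\<close>). As \<open>\<int>\<^sup>\<ell>\<close> is torsion-free, \<open>v \<sim> v + w\<close>
  with \<open>w \<noteq> 0\<close> forces an infinite class (\<open>unbounded_if_cong_translate\<close>), so the finite classes are
  partially ordered by the action of \<open>L\<close>, up to the free action of its units. Finally, finite
  subsets of \<open>\<int>\<^sup>\<ell>\<close> have unique sums (\<open>exists_unique_sum\<close>). If \<open>h \<notin> J\<close>, they single out a class in
  which exactly one product of a term of \<open>s\<close> with a term of \<open>h\<close> survives; its monomial lies in \<open>J\<close>,
  and a monomial in \<open>J\<close> has infinite class.

  The statement on monomials follows from the same restriction argument.
\<close>

section \<open>Minimal primes\<close>

text \<open>
  If \<open>a\<close> and \<open>b\<close> are outside \<open>M\<close>, maximality makes both \<open>M + (a)\<close> and \<open>M + (b)\<close> meet \<open>S\<close>. Were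
  \<open>a b\<close> in \<open>M\<close>, the product of two such elements of \<open>S\<close> would lie in \<open>M\<close>.
\<close>

lemma ideal_avoiding_maximal_is_prime:
  fixes R (structure)
  assumes "cring R" and M: "ideal M R"
    and S: "submonoid S R" and disj: "M \<inter> S = {}"
    and max: "\<And>K. \<lbrakk>ideal K R; M \<subseteq> K; K \<inter> S = {}\<rbrakk> \<Longrightarrow> K = M"
  shows "primeideal M R"
proof -
  interpret cring R by fact
  interpret M: ideal M R by fact
  interpret S: submonoid S R by fact
  have meets: "\<exists>m\<in>M. \<exists>r\<in>carrier R. m \<oplus> r \<otimes> a \<in> S" if a: "a \<in> carrier R" "a \<notin> M" for a
  proof -
    let ?K = "M <+>\<^bsub>R\<^esub> PIdl a"
    have K: "ideal ?K R"
      using add_ideals[OF M cgenideal_ideal[OF a(1)]] .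
    have sub: "M \<union> PIdl a \<subseteq> ?K"
      unfolding union_genideal[OF M cgenideal_ideal[OF a(1)], symmetric]
      using M.a_subset ideal.Icarr[OF cgenideal_ideal[OF a(1)]]
      by (intro genideal_self) auto
    have "?K \<noteq> M" using cgenideal_self[OF a(1)] sub a(2) by blast
    then have "?K \<inter> S \<noteq> {}" using max[OF K] sub by blast
    then show ?thesis by (auto simp: set_add_def' cgenideal_def)
  qed
  show ?thesis
  proof (rule primeidealI[OF M is_cring])
    show "carrier R \<noteq> M" using disj S.one_closed by auto
    fix a b assume ab: "a \<in> carrier R" "b \<in> carrier R" "a \<otimes> b \<in> M"
    show "a \<in> M \<or> b \<in> M"
    proof (rule ccontr)
      assume "\<not> (a \<in> M \<or> b \<in> M)"
      then obtain m r n q where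
        x: "m \<in> M" "r \<in> carrier R" "m \<oplus> r \<otimes> a \<in> S" and y: "n \<in> M" "q \<in> carrier R" "n \<oplus> q \<otimes> b \<in> S"
        using meets[OF ab(1)] meets[OF ab(2)] by blast
      note c = ab(1,2) x(2) y(2) M.Icarr[OF x(1)] M.Icarr[OF y(1)]
      have "(m \<oplus> r \<otimes> a) \<otimes> (n \<oplus> q \<otimes> b)
          = m \<otimes> (n \<oplus> q \<otimes> b) \<oplus> (r \<otimes> a \<otimes> n \<oplus> (r \<otimes> q) \<otimes> (a \<otimes> b))"
        using c by (simp add: l_distr r_distr m_ac a_ac)
      also have "\<dots> \<in> M"
        using c by (intro M.a_closed M.I_r_closed[OF x(1)] M.I_l_closed[OF y(1)] M.I_l_closed[OF ab(3)]) auto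
      finally show False using S.m_closed[OF x(3) y(3)] disj by blast
    qed
  qed
qed

text \<open>
  In the localization at \<open>P\<close> the only prime over \<open>I\<close> is the maximal ideal, so every element of \<open>P\<close>
  is nilpotent there modulo \<open>I\<close>. Without passing to the localization: if the multiplicative set of
  all \<open>s f\<^sup>n\<close> avoided \<open>I\<close>, an ideal over \<open>I\<close> maximal among those avoiding it would be a prime inside
  \<open>P\<close> that misses \<open>f\<close>.
\<close>

lemma minimal_prime_power_annihilated:
  fixes R (structure)
  assumes R: "cring R" and I: "ideal I R" and min: "minimal_prime_over R I P" and f: "f \<in> P"
  shows "\<exists>s\<in>carrier R - P. \<exists>n::nat. s \<otimes> f [^] n \<in> I"
proof (rule ccontr)
  assume neg: "\<not> (\<exists>s\<in>carrier R - P. \<exists>n::nat. s \<otimes> f [^] n \<in> I)"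
  interpret cring R by (rule R)
  interpret P: primeideal P R using min by (simp add: minimal_prime_over_def)
  have fR: "f \<in> carrier R" using f by (rule P.Icarr)
  define S where "S = {s \<otimes> f [^] n | s n. s \<in> carrier R - P \<and> (n::nat) \<in> UNIV}"
  have S: "submonoid S R"
  proof (rule submonoid.intro)
    show "S \<subseteq> carrier R" using fR by (auto simp: S_def)
    have "\<one> = \<one> \<otimes> f [^] (0::nat)" "\<one> \<in> carrier R - P" using P.one_imp_carrier P.I_notcarr by auto
    then show "\<one> \<in> S" unfolding S_def by blast
    fix x y assume "x \<in> S" "y \<in> S"
    then obtain s t and m n :: nat where
      st: "s \<in> carrier R - P" "t \<in> carrier R - P" "x = s \<otimes> f [^] m" "y = t \<otimes> f [^] n"
      by (auto simp: S_def)
    have "x \<otimes> y = (s \<otimes> t) \<otimes> f [^] (m + n)"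
      using st fR by (simp add: m_ac nat_pow_mult[symmetric])
    moreover have "s \<otimes> t \<in> carrier R - P" using st P.I_prime by auto
    ultimately show "x \<otimes> y \<in> S" unfolding S_def by blast
  qed
  define \<A> where "\<A> = {K. ideal K R \<and> I \<subseteq> K \<and> K \<inter> S = {}}"
  have "I \<in> \<A>" using neg I unfolding \<A>_def S_def by auto
  have "\<exists>M\<in>\<A>. \<forall>X\<in>\<A>. M \<subseteq> X \<longrightarrow> X = M"
  proof (rule subset_Zorn_nonempty)
    show "\<A> \<noteq> {}" using \<open>I \<in> \<A>\<close> by blast
    fix \<C> assume C: "\<C> \<noteq> {}" "subset.chain \<A> \<C>"
    have "subset.chain {K. ideal K R} \<C>"
      using C(2) by (auto simp: \<A>_def subset_chain_def)
    then have "ideal (\<Union>\<C>) R" using chain_Union_is_ideal[of \<C>] C(1) by simp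
    then show "\<Union>\<C> \<in> \<A>" using C by (fastforce simp: \<A>_def subset_chain_def)
  qed
  then obtain M where M: "M \<in> \<A>" and max: "\<And>X. \<lbrakk>X \<in> \<A>; M \<subseteq> X\<rbrakk> \<Longrightarrow> X = M" by blast
  have "primeideal M R"
  proof (rule ideal_avoiding_maximal_is_prime[OF R _ S])
    fix K assume "ideal K R" "M \<subseteq> K" "K \<inter> S = {}"
    then show "K = M" using M by (intro max) (auto simp: \<A>_def)
  qed (use M in \<open>auto simp: \<A>_def\<close>)
  moreover have "M \<subseteq> P"
  proof
    fix x assume x: "x \<in> M"
    have "x = x \<otimes> f [^] (0::nat)" "x \<in> carrier R"
      using x M ideal.Icarr unfolding \<A>_def by fastforce+
    then show "x \<in> P" using x M unfolding \<A>_def S_def by blast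
  qed
  ultimately have "M = P" using min M by (auto simp: minimal_prime_over_def \<A>_def)
  moreover have "f = \<one> \<otimes> f [^] (1::nat)" "\<one> \<in> carrier R - P"
    using fR P.one_imp_carrier P.I_notcarr by auto
  then have "f \<in> S" unfolding S_def by blast
  ultimately show False using M f unfolding \<A>_def by blast
qed

section \<open>Unique sums in free abelian groups\<close>

text \<open>
  With the coordinates numbered, the functional is \<open>x \<mapsto> \<Sum>\<^sub>i x\<^sub>i N\<^sup>i\<close>. A nonzero \<open>x\<close> in
  its kernel makes \<open>N\<close> a root of a nonzero polynomial, so all but finitely many \<open>N\<close> work.
\<close>

lemma exists_separating_functional:
  fixes D :: "(int ^ 'l) set"
  assumes "finite D"
  shows "\<exists>L :: int ^ 'l \<Rightarrow> int. (\<forall>x y. L (x + y) = L x + L y) \<and> (\<forall>x\<in>D. L x = 0 \<longrightarrow> x = 0)"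
proof -
  obtain e :: "'l \<Rightarrow> nat" where e: "inj e"
    using finite_imp_inj_to_nat_seg[OF finite[of "UNIV :: 'l set"]] by auto
  define p :: "int ^ 'l \<Rightarrow> int poly" where "p x = (\<Sum>i\<in>UNIV. monom (x $ i) (e i))" for x
  have nz: "p x \<noteq> 0" if "x \<noteq> 0" for x
  proof
    assume "p x = 0"
    have "x $ i = coeff (p x) (e i)" for i
      using e by (simp add: p_def coeff_sum inj_eq)
    then show False using \<open>p x = 0\<close> that by (simp add: vec_eq_iff)
  qed
  have "finite (\<Union>x\<in>D - {0}. {N. poly (p x) N = 0})"
    using assms nz by (auto intro!: poly_roots_finite)
  then obtain N where N: "N \<notin> (\<Union>x\<in>D - {0}. {N. poly (p x) N = 0})"
    using ex_new_if_finite[OF infinite_UNIV_int] by blast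
  show ?thesis
  proof (intro exI[of _ "\<lambda>x. poly (p x) N"] conjI allI ballI)
    show "poly (p (x + y)) N = poly (p x) N + poly (p y) N" for x y
      by (simp add: p_def poly_sum poly_monom distrib_right sum.distrib)
  qed (use N in auto)
qed

text \<open>
  Take the elements of \<open>A\<close> and \<open>B\<close> with largest value under a functional that is injective on \<open>A\<close>.
  This is the property of \<open>\<int>\<^sup>\<ell>\<close> that makes its group algebra a domain.
\<close>

lemma exists_unique_sum:
  fixes A B :: "(int ^ 'l) set"
  assumes "finite A" "A \<noteq> {}" "finite B" "B \<noteq> {}"
  shows "\<exists>a\<in>A. \<exists>b\<in>B. \<forall>a'\<in>A. \<forall>b'\<in>B. a' + b' = a + b \<longrightarrow> a' = a \<and> b' = b"
proof -
  define D where "D = (\<lambda>(x, y). x - y) ` (A \<times> A)"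
  obtain L :: "int ^ 'l \<Rightarrow> int" where add: "\<And>x y. L (x + y) = L x + L y" and inj: "\<And>x. \<lbrakk>x \<in> D; L x = 0\<rbrakk> \<Longrightarrow> x = 0"
    using exists_separating_functional[of D] assms unfolding D_def by blast
  have maximizer: "\<exists>x\<in>X. \<forall>y\<in>X. L y \<le> L x" if X: "finite X" "X \<noteq> {}" for X
  proof -
    have "Max (L ` X) \<in> L ` X" using X by (intro Max_in) auto
    then obtain x where "x \<in> X" "L x = Max (L ` X)" by auto
    then show ?thesis using X(1) by (auto intro!: bexI[of _ x])
  qed
  obtain a where a: "a \<in> A" "\<And>x. x \<in> A \<Longrightarrow> L x \<le> L a"
    using maximizer[OF assms(1,2)] by blast
  obtain b where b: "b \<in> B" "\<And>x. x \<in> B \<Longrightarrow> L x \<le> L b"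
    using maximizer[OF assms(3,4)] by blast
  have "a' = a \<and> b' = b" if h: "a' \<in> A" "b' \<in> B" "a' + b' = a + b" for a' b'
  proof -
    have "L a' + L b' = L a + L b" using h(3) add by metis
    then have "L a' = L a" using a(2)[OF h(1)] b(2)[OF h(2)] by linarith
    moreover have "L (a' - a) + L a = L a'" using add[of "a' - a" a] by simp
    ultimately have "a' - a = 0" using inj[of "a' - a"] h(1) a(1) by (auto simp: D_def)
    then show ?thesis using h(3) by simp
  qed
  then show ?thesis using a(1) b(1) by blast
qed

section \<open>Ideals of semigroup algebras\<close>

lemma carrier_semigroup_algebra:
  "carrier (semigroup_algebra M :: ('a::comm_monoid_add \<Rightarrow>\<^sub>0 'k::field) ring) = {f. Poly_Mapping.keys f \<subseteq> M}"
  by (simp add: semigroup_algebra_def monomial_span_eq)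

lemma semigroup_algebra_ops [simp]:
  "monoid.mult (semigroup_algebra M) = (*)" "add (semigroup_algebra M) = (+)"
  "one (semigroup_algebra M) = 1" "zero (semigroup_algebra M) = 0"
  by (simp_all add: semigroup_algebra_def)

lemma semigroup_algebra_pow [simp]: "f [^]\<^bsub>semigroup_algebra M\<^esub> (n::nat) = f ^ n"
  by (induction n) (simp_all add: nat_pow_def mult.commute)

lemma poly_mapping_sum_single:
  "(f :: 'a \<Rightarrow>\<^sub>0 'k::comm_monoid_add)
    = (\<Sum>u\<in>Poly_Mapping.keys f. Poly_Mapping.single u (Poly_Mapping.lookup f u))"
  by (rule poly_mapping_eqI)
    (auto simp: lookup_sum lookup_single when_def in_keys_iff sum.delta' if_distrib cong: if_cong)

text \<open>
  Closure under multiplication by terms suffices: every element is a sum of terms, and negation is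
  multiplication by the term \<open>-1\<close>.
\<close>

lemma ideal_semigroup_algebraI:
  fixes J :: "('a::comm_monoid_add \<Rightarrow>\<^sub>0 'k::field) set"
  assumes M: "additive_submonoid M"
    and sub: "\<And>f. f \<in> J \<Longrightarrow> Poly_Mapping.keys f \<subseteq> M"
    and zero: "0 \<in> J"
    and add: "\<And>f g. \<lbrakk>f \<in> J; g \<in> J\<rbrakk> \<Longrightarrow> f + g \<in> J"
    and mult: "\<And>u c f. \<lbrakk>u \<in> M; f \<in> J\<rbrakk> \<Longrightarrow> Poly_Mapping.single u c * f \<in> J"
  shows "ideal J (semigroup_algebra M)"
proof -
  interpret cring "semigroup_algebra M :: ('a \<Rightarrow>\<^sub>0 'k) ring"
    by (rule cring_semigroup_algebra[OF M])
  have "r * f \<in> J" if f: "f \<in> J" and r: "Poly_Mapping.keys r \<subseteq> M" for r f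
  proof -
    have "(\<Sum>u\<in>K. Poly_Mapping.single u (Poly_Mapping.lookup r u)) * f \<in> J"
      if "finite K" "K \<subseteq> M" for K
      using that by (induction K rule: finite_induct) (auto simp: distrib_right zero f intro!: add mult)
    from this[of "Poly_Mapping.keys r"] show ?thesis
      using r by (simp flip: poly_mapping_sum_single)
  qed
  note closed = this
  have "- f = Poly_Mapping.single 0 (-1) * f" for f :: "'a \<Rightarrow>\<^sub>0 'k"
    by (metis mult_minus1 single_one single_uminus)
  then have neg: "- f \<in> J" if "f \<in> J" for f
    using mult[of 0 f "-1"] M that by (simp add: additive_submonoid_def)
  show ?thesis
  proof (rule idealI)
    show "ring (semigroup_algebra M :: ('a \<Rightarrow>\<^sub>0 'k) ring)" ..
    show "subgroup J (add_monoid (semigroup_algebra M))"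
    proof (rule add.subgroupI)
      show "J \<subseteq> carrier (semigroup_algebra M)" using sub by (auto simp: carrier_semigroup_algebra)
      show "J \<noteq> {}" using zero by blast
      fix f assume f: "f \<in> J"
      have "\<ominus>\<^bsub>semigroup_algebra M\<^esub> f = - f"
        using sub[OF f] sub[OF neg[OF f]]
        by (intro minus_equality) (auto simp: carrier_semigroup_algebra)
      then show "\<ominus>\<^bsub>semigroup_algebra M\<^esub> f \<in> J" using neg[OF f] by simp
    qed (use add in auto)
  qed (use closed in \<open>auto simp: carrier_semigroup_algebra mult.commute\<close>)
qed

locale semigroup_algebra_ideal =
  fixes L :: "'a::ab_group_add set" and J :: "('a \<Rightarrow>\<^sub>0 'k::field) set"
  assumes submonoid: "additive_submonoid L"
    and ideal: "ideal J (semigroup_algebra L)"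
begin

lemma zero_in: "0 \<in> L" and add_in: "\<lbrakk>u \<in> L; v \<in> L\<rbrakk> \<Longrightarrow> u + v \<in> L"
  using submonoid by (auto simp: additive_submonoid_def)

lemma keys_subset: "f \<in> J \<Longrightarrow> Poly_Mapping.keys f \<subseteq> L"
  using ideal.Icarr[OF ideal, of f] by (simp add: carrier_semigroup_algebra)

lemma ideal_zero: "0 \<in> J"
  using additive_subgroup.zero_closed[OF ideal.axioms(1)[OF ideal]] by simp

lemma ideal_add: "\<lbrakk>f \<in> J; g \<in> J\<rbrakk> \<Longrightarrow> f + g \<in> J"
  using additive_subgroup.a_closed[OF ideal.axioms(1)[OF ideal], of f g] by simp

lemma ideal_mult: "\<lbrakk>f \<in> J; Poly_Mapping.keys r \<subseteq> L\<rbrakk> \<Longrightarrow> r * f \<in> J"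
  using ideal.I_l_closed[OF ideal, of f r] by (simp add: carrier_semigroup_algebra)

lemma ideal_single: "\<lbrakk>f \<in> J; u \<in> L\<rbrakk> \<Longrightarrow> Poly_Mapping.single u c * f \<in> J"
  by (rule ideal_mult) auto

lemma ideal_uminus: "f \<in> J \<Longrightarrow> - f \<in> J"
  using ideal_mult[of f "- 1"] zero_in by simp

lemma ideal_diff: "\<lbrakk>f \<in> J; g \<in> J\<rbrakk> \<Longrightarrow> f - g \<in> J"
  using ideal_add[of f "- g"] ideal_uminus by simp

lemma ideal_diff_iff: "f - g \<in> J \<Longrightarrow> f \<in> J \<longleftrightarrow> g \<in> J"
  using ideal_add[of "f - g" g] ideal_diff[of f "f - g"] by auto

definition cong :: "('a \<times> 'a) set" where
  "cong = {(u, v). u \<in> L \<and> v \<in> L \<and> (\<exists>c. c \<noteq> 0 \<and> tmon u - scal c (tmon v) \<in> J)}"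

definition unbounded :: "'a set" where
  "unbounded = {u \<in> L. infinite (cong `` {u})}"

lemma congI: "\<lbrakk>u \<in> L; v \<in> L; c \<noteq> 0; tmon u - Poly_Mapping.single v c \<in> J\<rbrakk> \<Longrightarrow> (u, v) \<in> cong"
  by (auto simp: cong_def)

lemma congE:
  assumes "(u, v) \<in> cong"
  obtains c where "u \<in> L" "v \<in> L" "c \<noteq> 0" "tmon u - Poly_Mapping.single v c \<in> J"
  using assms by (auto simp: cong_def)

lemma cong_refl: "u \<in> L \<Longrightarrow> (u, u) \<in> cong"
  by (rule congI[of _ _ 1]) (auto simp: ideal_zero)

lemma cong_sym: assumes "(u, v) \<in> cong" shows "(v, u) \<in> cong"
proof -
  obtain c where c: "u \<in> L" "v \<in> L" "c \<noteq> 0" "tmon u - Poly_Mapping.single v c \<in> J"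
    using assms by (rule congE)
  have "Poly_Mapping.single 0 (- inverse c) * (tmon u - Poly_Mapping.single v c) \<in> J"
    using c zero_in by (intro ideal_single)
  also have "Poly_Mapping.single 0 (- inverse c) * (tmon u - Poly_Mapping.single v c)
      = tmon v - Poly_Mapping.single u (inverse c)"
    using c(3) by (simp add: right_diff_distrib mult_single single_uminus)
  finally show ?thesis using c by (intro congI[of _ _ "inverse c"]) auto
qed

lemma cong_trans: assumes "(u, v) \<in> cong" "(v, w) \<in> cong" shows "(u, w) \<in> cong"
proof -
  obtain c where c: "u \<in> L" "v \<in> L" "c \<noteq> 0" "tmon u - Poly_Mapping.single v c \<in> J"
    using assms(1) by (rule congE)
  obtain d where d: "w \<in> L" "d \<noteq> 0" "tmon v - Poly_Mapping.single w d \<in> J"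
    using assms(2) by (rule congE)
  have "(tmon u - Poly_Mapping.single v c)
      + Poly_Mapping.single 0 c * (tmon v - Poly_Mapping.single w d) \<in> J"
    using c d zero_in by (intro ideal_add ideal_single)
  also have "(tmon u - Poly_Mapping.single v c)
      + Poly_Mapping.single 0 c * (tmon v - Poly_Mapping.single w d)
      = tmon u - Poly_Mapping.single w (c * d)"
    by (simp add: right_diff_distrib mult_single)
  finally show ?thesis using c d by (intro congI[of _ _ "c * d"]) auto
qed

lemma cong_add: assumes "(u, v) \<in> cong" "w \<in> L" shows "(u + w, v + w) \<in> cong"
proof -
  obtain c where c: "u \<in> L" "v \<in> L" "c \<noteq> 0" "tmon u - Poly_Mapping.single v c \<in> J"
    using assms(1) by (rule congE)
  have "tmon w * (tmon u - Poly_Mapping.single v c) \<in> J" using c assms by (intro ideal_single)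
  then show ?thesis using c assms(2)
    by (intro congI[of _ _ c]) (auto simp: add_in right_diff_distrib mult_single add.commute)
qed

lemma cong_class_eq: "(u, v) \<in> cong \<Longrightarrow> cong `` {u} = cong `` {v}"
  using cong_sym cong_trans by blast

lemma unbounded_cong: "(u, v) \<in> cong \<Longrightarrow> u \<in> unbounded \<longleftrightarrow> v \<in> unbounded"
  using cong_class_eq by (auto simp: unbounded_def elim: congE)

text \<open>
  Translation by \<open>w\<close> maps the class of \<open>u\<close> injectively into the class of \<open>u + w\<close>.
\<close>

lemma unbounded_add: assumes "u \<in> unbounded" "w \<in> L" shows "u + w \<in> unbounded"
proof -
  have "(\<lambda>v. v + w) ` (cong `` {u}) \<subseteq> cong `` {u + w}" using cong_add assms(2) by auto
  moreover have "infinite ((\<lambda>v. v + w) ` (cong `` {u}))"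
    using assms(1) by (subst finite_image_iff) (auto simp: unbounded_def inj_on_def)
  ultimately have "infinite (cong `` {u + w})" using finite_subset by blast
  then show ?thesis using assms add_in by (auto simp: unbounded_def)
qed

lemma cong_of_monomials_in_ideal:
  assumes "tmon u \<in> J" "tmon v \<in> J" shows "(u, v) \<in> cong"
  using keys_subset[OF assms(1)] keys_subset[OF assms(2)] ideal_diff[OF assms]
  by (intro congI[of _ _ 1]) auto

end

section \<open>Restricting elements of binomial ideals to congruence classes\<close>

definition restrict_keys :: "'a set \<Rightarrow> ('a \<Rightarrow>\<^sub>0 'k::comm_monoid_add) \<Rightarrow> ('a \<Rightarrow>\<^sub>0 'k)" where
  "restrict_keys S f
    = (\<Sum>u\<in>Poly_Mapping.keys f \<inter> S. Poly_Mapping.single u (Poly_Mapping.lookup f u))"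

lemma lookup_restrict_keys:
  "Poly_Mapping.lookup (restrict_keys S f) x = (if x \<in> S then Poly_Mapping.lookup f x else 0)"
  by (auto simp: restrict_keys_def lookup_sum lookup_single when_def in_keys_iff sum.delta' if_distrib cong: if_cong)

lemma keys_restrict_keys: "Poly_Mapping.keys (restrict_keys S f) = Poly_Mapping.keys f \<inter> S"
  by (auto simp: in_keys_iff lookup_restrict_keys split: if_splits)

lemma restrict_keys_add: "restrict_keys S (f + g) = restrict_keys S f + restrict_keys S g"
  by (rule poly_mapping_eqI) (simp add: lookup_restrict_keys lookup_add)

lemma restrict_keys_zero [simp]: "restrict_keys S 0 = 0"
  by (rule poly_mapping_eqI) (simp add: lookup_restrict_keys)

lemma restrict_keys_sum: "restrict_keys S (\<Sum>i\<in>A. f i) = (\<Sum>i\<in>A. restrict_keys S (f i))"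
  by (induction A rule: infinite_finite_induct) (simp_all add: restrict_keys_add)

lemma restrict_keys_eq_self: "Poly_Mapping.keys f \<subseteq> S \<Longrightarrow> restrict_keys S f = f"
  by (rule poly_mapping_eqI) (auto simp: lookup_restrict_keys in_keys_iff)

lemma restrict_keys_eq_zero: "Poly_Mapping.keys f \<inter> S = {} \<Longrightarrow> restrict_keys S f = 0"
  by (rule poly_mapping_eqI) (auto simp: lookup_restrict_keys in_keys_iff)

lemma restrict_keys_single:
  "restrict_keys S (Poly_Mapping.single u c) = (if u \<in> S then Poly_Mapping.single u c else 0)"
  by (rule poly_mapping_eqI) (auto simp: lookup_restrict_keys lookup_single when_def)

lemma restrict_keys_single_mult:
  fixes f :: "'a::ab_group_add \<Rightarrow>\<^sub>0 'k::semiring_0"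
  shows "restrict_keys S (Poly_Mapping.single u c * f)
    = Poly_Mapping.single u c * restrict_keys {x. x + u \<in> S} f"
proof -
  have "restrict_keys S (Poly_Mapping.single u c * (\<Sum>v\<in>K. Poly_Mapping.single v (a v)))
      = Poly_Mapping.single u c * restrict_keys {x. x + u \<in> S} (\<Sum>v\<in>K. Poly_Mapping.single v (a v))"
    for K a
    unfolding sum_distrib_left restrict_keys_sum mult_single
    by (intro sum.cong refl) (simp add: restrict_keys_single mult_single add.commute)
  from this[of "Poly_Mapping.lookup f" "Poly_Mapping.keys f"] show ?thesis
    by (simp flip: poly_mapping_sum_single)
qed

lemma mult_sum_single:
  fixes f g :: "'a::monoid_add \<Rightarrow>\<^sub>0 'k::semiring_0"
  shows "f * g = (\<Sum>(u, v)\<in>Poly_Mapping.keys f \<times> Poly_Mapping.keys g.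
    Poly_Mapping.single (u + v) (Poly_Mapping.lookup f u * Poly_Mapping.lookup g v))"
proof -
  have "f * g = (\<Sum>u\<in>Poly_Mapping.keys f. Poly_Mapping.single u (Poly_Mapping.lookup f u))
      * (\<Sum>v\<in>Poly_Mapping.keys g. Poly_Mapping.single v (Poly_Mapping.lookup g v))"
    by (simp flip: poly_mapping_sum_single)
  then show ?thesis by (simp add: sum_product mult_single sum.cartesian_product)
qed

locale binomial_semigroup_algebra_ideal = semigroup_algebra_ideal +
  assumes binomial: "binomial_ideal L J"
begin

text \<open>
  Restriction to \<open>S\<close> sends a binomial in \<open>J\<close> to itself or to \<open>0\<close>, because its two exponents are
  congruent; for a monomial this is clear. The elements with the asserted property for all saturated \<open>S\<close> at once form an ideal:
  restricting \<open>t\<^sup>u f\<close> to \<open>S\<close> amounts to restricting \<open>f\<close> to the translate of \<open>S\<close> by \<open>-u\<close>, which is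
  saturated again.
\<close>

lemma restrict_keys_in_ideal:
  assumes "f \<in> J" and S: "\<And>u v. \<lbrakk>(u, v) \<in> cong; u \<in> S\<rbrakk> \<Longrightarrow> v \<in> S"
  shows "restrict_keys S f \<in> J"
proof -
  define sat where "sat S \<longleftrightarrow> (\<forall>u v. (u, v) \<in> cong \<longrightarrow> u \<in> S \<longrightarrow> v \<in> S)" for S
  define T where "T = {f :: 'a \<Rightarrow>\<^sub>0 'b. Poly_Mapping.keys f \<subseteq> L \<and> (\<forall>S. sat S \<longrightarrow> restrict_keys S f \<in> J)}"
  have T: "ideal T (semigroup_algebra L)"
  proof (rule ideal_semigroup_algebraI[OF submonoid])
    fix f g assume "f \<in> T" "g \<in> T"
    then show "f + g \<in> T"
      using keys_add[of f g] by (auto simp: T_def restrict_keys_add intro: ideal_add)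
  next
    fix u c f assume u: "u \<in> L" and f: "f \<in> T"
    have "Poly_Mapping.keys (Poly_Mapping.single u c * f) \<subseteq> L"
      using keys_mult[of "Poly_Mapping.single u c" f] f u add_in by (fastforce simp: T_def split: if_splits)
    moreover have "restrict_keys S (Poly_Mapping.single u c * f) \<in> J" if "sat S" for S
    proof -
      have "sat {x. x + u \<in> S}" using that cong_add[OF _ u] unfolding sat_def by blast
      then show ?thesis
        using f u unfolding restrict_keys_single_mult by (intro ideal_single) (auto simp: T_def)
    qed
    ultimately show "Poly_Mapping.single u c * f \<in> T" by (simp add: T_def)
  qed (auto simp: T_def ideal_zero)
  obtain B where B: "B \<subseteq> {tmon u - scal c (tmon v) | u v c. u \<in> L \<and> v \<in> L}"
    and J: "J = Idl\<^bsub>semigroup_algebra L\<^esub> B"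
    using binomial by (auto simp: binomial_ideal_def)
  interpret cring "semigroup_algebra L :: ('a \<Rightarrow>\<^sub>0 'b) ring"
    by (rule cring_semigroup_algebra[OF submonoid])
  have keysB: "Poly_Mapping.keys f \<subseteq> L" if "f \<in> B" for f
    using B that keys_diff by (fastforce split: if_splits)
  then have BJ: "B \<subseteq> J" unfolding J by (intro genideal_self) (auto simp: carrier_semigroup_algebra)
  have "B \<subseteq> T"
  proof
    fix f assume f: "f \<in> B"
    then obtain u v c where uv: "f = tmon u - Poly_Mapping.single v c" "u \<in> L" "v \<in> L"
      using B by auto
    have "restrict_keys S f \<in> J" if S: "sat S" for S
    proof -
      have "Poly_Mapping.keys f \<subseteq> S \<or> Poly_Mapping.keys f \<inter> S = {}"
      proof (cases "c = 0")
        case False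
        then have "(u, v) \<in> cong" using uv f BJ by (intro congI) auto
        then have "u \<in> S \<longleftrightarrow> v \<in> S" using S cong_sym unfolding sat_def by blast
        then show ?thesis
          using keys_diff[of "tmon u" "Poly_Mapping.single v c"] False unfolding uv(1) by auto
      qed (simp add: uv(1))
      then have "restrict_keys S f = f \<or> restrict_keys S f = 0"
        using restrict_keys_eq_self restrict_keys_eq_zero by blast
      then show ?thesis using f BJ ideal_zero by auto
    qed
    then show "f \<in> T" using keysB[OF f] by (simp add: T_def)
  qed
  then have "J \<subseteq> T" unfolding J by (intro genideal_minimal[OF T])
  then show ?thesis using assms by (auto simp: T_def sat_def)
qed

end

section \<open>Bounded classes\<close>

locale lattice_binomial_ideal = binomial_semigroup_algebra_ideal L J
  for L :: "(int ^ 'l) set" and J :: "((int ^ 'l) \<Rightarrow>\<^sub>0 'k::field) set" +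
  assumes proper: "1 \<notin> J"
begin

text \<open>
  By iteration the class of \<open>v\<close> contains all \<open>v + n w\<close>, which are distinct since \<open>\<int>\<^sup>\<ell>\<close> is torsion-free.
\<close>

lemma unbounded_if_cong_translate:
  assumes "(v, v + w) \<in> cong" "w \<in> L" "w \<noteq> 0"
  shows "v \<in> unbounded"
proof -
  have v: "v \<in> L" using assms(1) by (auto elim: congE)
  have c: "(v, v + of_nat n * w) \<in> cong" for n
  proof (induction n)
    case (Suc n)
    have "(v + w, v + of_nat n * w + w) \<in> cong" using cong_add[OF Suc assms(2)] .
    then show ?case using cong_trans[OF assms(1)] by (simp add: algebra_simps)
  qed (simp add: cong_refl v)
  obtain i where i: "w $ i \<noteq> 0" using assms(3) by (auto simp: vec_eq_iff)
  have "inj (\<lambda>n::nat. v + of_nat n * w)"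
  proof (rule injI)
    fix m n :: nat assume "v + of_nat m * w = v + of_nat n * w"
    then have "(of_nat m * w) $ i = (of_nat n * w) $ i" by simp
    then show "m = n" using i by (simp add: of_nat_index)
  qed
  then have "infinite (range (\<lambda>n::nat. v + of_nat n * w))" using finite_imageD infinite_UNIV_nat by blast
  moreover have "range (\<lambda>n::nat. v + of_nat n * w) \<subseteq> cong `` {v}" using c by blast
  ultimately show ?thesis using v finite_subset by (auto simp: unbounded_def)
qed

text \<open>
  The monomials in \<open>J\<close> form one class, which contains \<open>2u\<close> together with \<open>u\<close>; properness of \<open>J\<close>
  excludes \<open>u = 0\<close>.
\<close>

lemma monomial_in_ideal_unbounded:
  assumes "tmon u \<in> J" shows "u \<in> unbounded"
proof (rule unbounded_if_cong_translate)
  show u: "u \<in> L" using keys_subset[OF assms] by simp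
  show "u \<noteq> 0" using assms proper by auto
  have "tmon (u + u) \<in> J" using ideal_single[OF assms u, of 1] by (simp add: mult_single)
  then show "(u, u + u) \<in> cong" using assms by (rule cong_of_monomials_in_ideal[rotated])
qed

text \<open>
  Modulo \<open>J\<close> and the monomials with infinite class, an element \<open>s\<close> in which a unit of \<open>L\<close> occurs is a
  nonzerodivisor. After replacing congruent monomials by one another, the monomials of \<open>h\<close> are
  pairwise incongruent. Moving up by non-units of \<open>L\<close> is a strict order on finite classes, so \<open>h\<close>
  has a minimal monomial \<open>m\<close>. The products that land in the orbit of \<open>m\<close> under the units of \<open>L\<close> come
  from unit monomials of \<open>s\<close> and monomials of \<open>h\<close> in that same orbit, on which the units act freely.
  A unique sum then isolates a single product.
\<close>

lemma cancel_unit_key: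
  assumes s: "Poly_Mapping.keys s \<subseteq> L" and unit: "w\<^sub>0 \<in> Poly_Mapping.keys s" "- w\<^sub>0 \<in> L"
    and g: "Poly_Mapping.keys g \<subseteq> unbounded"
  shows "\<lbrakk>Poly_Mapping.keys h \<subseteq> L - unbounded; j \<in> J; s * h = j + g\<rbrakk> \<Longrightarrow> h \<in> J"
proof (induction "card (Poly_Mapping.keys h)" arbitrary: h j rule: less_induct)
  case less
  note h = less.prems(1) and j = less.prems(2) and eq = less.prems(3)
  show ?case
  proof (cases "\<exists>u\<in>Poly_Mapping.keys h. \<exists>v\<in>Poly_Mapping.keys h. u \<noteq> v \<and> (u, v) \<in> cong")
    case True
    then obtain u v where uv: "u \<in> Poly_Mapping.keys h" "v \<in> Poly_Mapping.keys h" "u \<noteq> v" "(u, v) \<in> cong"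
      by blast
    obtain c where c: "tmon u - Poly_Mapping.single v c \<in> J" using uv(4) by (rule congE)
    define d where "d = Poly_Mapping.lookup h u"
    define e where "e = Poly_Mapping.single u d - Poly_Mapping.single v (d * c)"
    have "e = Poly_Mapping.single 0 d * (tmon u - Poly_Mapping.single v c)"
      by (simp add: e_def right_diff_distrib mult_single)
    then have e: "e \<in> J" using ideal_single[OF c zero_in] by simp
    have keys: "Poly_Mapping.keys (h - e) \<subseteq> Poly_Mapping.keys h - {u}"
      using uv by (auto simp: in_keys_iff e_def d_def lookup_minus lookup_single when_def split: if_splits)
    have "card (Poly_Mapping.keys (h - e)) \<le> card (Poly_Mapping.keys h - {u})"
      by (rule card_mono[OF _ keys]) simp
    also have "\<dots> < card (Poly_Mapping.keys h)" by (rule card_Diff1_less) (use uv in auto)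
    finally have "h - e \<in> J"
    proof (rule less.hyps)
      show "Poly_Mapping.keys (h - e) \<subseteq> L - unbounded" using keys h by blast
      show "j - s * e \<in> J" using j e s by (intro ideal_diff ideal_mult)
      show "s * (h - e) = (j - s * e) + g" using eq by (simp add: right_diff_distrib)
    qed
    then show ?thesis using ideal_diff_iff[of h "h - e"] e by simp
  next
    case False
    then have ineq: "u = v" if "u \<in> Poly_Mapping.keys h" "v \<in> Poly_Mapping.keys h" "(u, v) \<in> cong" for u v
      using that by blast
    show ?thesis
    proof (cases "h = 0")
      case False
      \<comment> \<open>strict, because a finite class is moved by every nonzero translation\<close>
      define below where "below u v \<longleftrightarrow> (\<exists>w\<in>L. - w \<notin> L \<and> (u + w, v) \<in> cong)" for u v
      have asym: "\<not> below v u" if uv: "u \<in> Poly_Mapping.keys h" "below u v" for u v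
      proof
        assume "below v u"
        then obtain w w' where w: "w \<in> L" "- w \<notin> L" "(u + w, v) \<in> cong" "w' \<in> L" "(v + w', u) \<in> cong"
          using uv(2) unfolding below_def by blast
        have "(u + w + w', u) \<in> cong" using cong_trans[OF cong_add[OF w(3,4)] w(5)] .
        then have "(u, u + (w + w')) \<in> cong" using cong_sym by (simp add: add.assoc)
        moreover have "w + w' \<noteq> 0"
        proof
          assume "w + w' = 0"
          then have "- w = w'" by (rule minus_unique)
          then show False using w by simp
        qed
        ultimately have "u \<in> unbounded" using w add_in by (intro unbounded_if_cong_translate) auto
        then show False using uv(1) h by blast
      qed
      have trans: "below u x" if uvx: "below u v" "below v x" for u v x
      proof -
        obtain w w' where w: "w \<in> L" "- w \<notin> L" "(u + w, v) \<in> cong" "w' \<in> L" "(v + w', x) \<in> cong"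
          using uvx unfolding below_def by blast
        have "(u + (w + w'), x) \<in> cong"
          using cong_trans[OF cong_add[OF w(3,4)] w(5)] by (simp add: add.assoc)
        moreover have "- (w + w') \<notin> L" using w(2) add_in[OF _ w(4), of "- (w + w')"] by auto
        ultimately show ?thesis unfolding below_def using w add_in by blast
      qed
      have "asymp_on (Poly_Mapping.keys h) below" using asym by (auto intro!: asymp_onI)
      moreover have "transp_on (Poly_Mapping.keys h) below" using trans by (auto intro!: transp_onI)
      moreover have "Poly_Mapping.keys h \<noteq> {}" using False by simp
      ultimately obtain m where m: "m \<in> Poly_Mapping.keys h"
        and min': "\<And>x. \<lbrakk>x \<in> Poly_Mapping.keys h; x \<noteq> m\<rbrakk> \<Longrightarrow> \<not> below x m"
        using Finite_Set.bex_min_element[OF finite_keys] by metis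
      have min: "\<not> below x m" if "x \<in> Poly_Mapping.keys h" for x
        using min' asym that by blast
      \<comment> \<open>monomials of \<open>h\<close> in the orbit of \<open>m\<close>, with the unique unit that carries each of them to \<open>m\<close>\<close>
      define T where "T = {(v, z). v \<in> Poly_Mapping.keys h \<and> z \<in> L \<and> - z \<in> L \<and> (v + z, m) \<in> cong}"
      have T: "z = z'" if zz: "(v, z) \<in> T" "(v, z') \<in> T" for v z z'
      proof (rule ccontr)
        assume "z \<noteq> z'"
        have "(v + z, v + z') \<in> cong" using zz cong_sym cong_trans unfolding T_def by blast
        then have "(v + z, v + z + (z' - z)) \<in> cong" by (simp add: algebra_simps)
        moreover have "z' - z \<in> L" using zz add_in[of z' "- z"] by (auto simp: T_def)
        ultimately have "v + z \<in> unbounded"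
          using \<open>z \<noteq> z'\<close> by (intro unbounded_if_cong_translate) auto
        then have "m \<in> unbounded" using zz unbounded_cong by (auto simp: T_def)
        then show False using m h by blast
      qed
      have "finite T"
      proof (rule finite_imageD)
        show "finite (fst ` T)" by (rule finite_subset[OF _ finite_keys[of h]]) (auto simp: T_def)
        show "inj_on fst T" using T by (auto simp: inj_on_def)
      qed
      \<comment> \<open>The product of \<open>w \<in> A\<close> with the monomial paired with \<open>z\<close> lies in the class of \<open>m + w - z\<close>, so
        a unique sum of \<open>A\<close> and \<open>B = {-z}\<close> yields a class reached by exactly one product.\<close>
      define A where "A = {w \<in> Poly_Mapping.keys s. - w \<in> L}"
      define B where "B = (\<lambda>(v, z). - z) ` T"
      have "(m, 0) \<in> T" using m h cong_refl zero_in by (auto simp: T_def)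
      then have "finite A" "A \<noteq> {}" "finite B" "B \<noteq> {}"
        using unit \<open>finite T\<close> by (auto simp: A_def B_def)
      from exists_unique_sum[OF this] obtain a b where "a \<in> A" "b \<in> B"
        and unique: "\<And>a' b'. \<lbrakk>a' \<in> A; b' \<in> B; a' + b' = a + b\<rbrakk> \<Longrightarrow> a' = a \<and> b' = b"
        by metis
      then obtain v where v: "(v, - b) \<in> T" by (auto simp: B_def)
      have aL: "a \<in> L" "- a \<in> L" "a \<in> Poly_Mapping.keys s" using \<open>a \<in> A\<close> s by (auto simp: A_def)
      have vb: "v \<in> Poly_Mapping.keys h" "b \<in> L" "- b \<in> L" "(v - b, m) \<in> cong" using v by (auto simp: T_def)
      define S where "S = cong `` {v + a}"
      have va: "v + a \<notin> unbounded" using unbounded_add[of "v + a" "- a"] aL vb h by auto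
      have single: "w = a \<and> v' = v"
        if w: "w \<in> Poly_Mapping.keys s" and v': "v' \<in> Poly_Mapping.keys h" and wv: "w + v' \<in> S" for w v'
      proof -
        have wL: "w \<in> L" using w s by blast
        have ba: "- b + - a \<in> L" using vb aL add_in by blast
        define z where "z = w - b - a"
        have zL: "z \<in> L" using add_in[OF wL ba] by (simp add: z_def algebra_simps)
        have "(v + a + (- b + - a), w + v' + (- b + - a)) \<in> cong"
          using wv ba by (intro cong_add) (auto simp: S_def)
        then have "(v - b, v' + z) \<in> cong" by (simp add: z_def algebra_simps)
        then have vz: "(v' + z, m) \<in> cong" using vb(4) cong_sym cong_trans by blast
        then have mz: "- z \<in> L" using min[OF v'] zL unfolding below_def by blast
        then have "- w \<in> L" using add_in[OF mz ba] by (simp add: z_def algebra_simps)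
        then have "w \<in> A" using w by (simp add: A_def)
        moreover have vzT: "(v', z) \<in> T" using vz mz zL v' by (simp add: T_def)
        then have "- z \<in> B" by (force simp: B_def)
        moreover have "w + - z = a + b" by (simp add: z_def)
        ultimately have "w = a" "- z = b" using unique by blast+
        then have "z = - b" by auto
        then have "(v' + - b, v + - b) \<in> cong"
          using vzT v cong_sym cong_trans unfolding T_def by blast
        then have "(v' + - b + b, v + - b + b) \<in> cong" using vb(2) by (rule cong_add)
        then show ?thesis using ineq[OF v' vb(1)] \<open>w = a\<close> by simp
      qed
      define c where "c = Poly_Mapping.lookup s a * Poly_Mapping.lookup h v"
      have "restrict_keys S (s * h) = (\<Sum>(w, v')\<in>Poly_Mapping.keys s \<times> Poly_Mapping.keys h.
          restrict_keys S (Poly_Mapping.single (w + v') (Poly_Mapping.lookup s w * Poly_Mapping.lookup h v')))"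
        by (subst mult_sum_single) (simp add: restrict_keys_sum case_prod_unfold)
      also have "\<dots> = (\<Sum>(w, v')\<in>{(a, v)}.
          restrict_keys S (Poly_Mapping.single (w + v') (Poly_Mapping.lookup s w * Poly_Mapping.lookup h v')))"
      proof (rule sum.mono_neutral_right)
        show "\<forall>i\<in>Poly_Mapping.keys s \<times> Poly_Mapping.keys h - {(a, v)}. (case i of (w, v') \<Rightarrow>
            restrict_keys S (Poly_Mapping.single (w + v') (Poly_Mapping.lookup s w * Poly_Mapping.lookup h v'))) = 0"
        proof
          fix i assume i: "i \<in> Poly_Mapping.keys s \<times> Poly_Mapping.keys h - {(a, v)}"
          obtain w v' where "i = (w, v')" by (cases i)
          then have "w + v' \<notin> S" using i single by blast
          then show "(case i of (w, v') \<Rightarrow>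
            restrict_keys S (Poly_Mapping.single (w + v') (Poly_Mapping.lookup s w * Poly_Mapping.lookup h v'))) = 0"
            by (simp add: \<open>i = (w, v')\<close> restrict_keys_single)
        qed
      qed (use aL vb in auto)
      also have "\<dots> = Poly_Mapping.single (v + a) c"
        using cong_refl[of "v + a"] add_in[of v a] aL vb h
        by (auto simp: restrict_keys_single S_def c_def add.commute)
      finally have 1: "restrict_keys S (s * h) = Poly_Mapping.single (v + a) c" .
      have "restrict_keys S g = 0"
      proof (rule restrict_keys_eq_zero)
        show "Poly_Mapping.keys g \<inter> S = {}" using g va unbounded_cong by (auto simp: S_def)
      qed
      then have "Poly_Mapping.single (v + a) c = restrict_keys S j"
        using 1 eq by (simp add: restrict_keys_add)
      also have "\<dots> \<in> J" using j by (rule restrict_keys_in_ideal) (auto simp: S_def intro: cong_trans)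
      finally have "Poly_Mapping.single 0 (inverse c) * Poly_Mapping.single (v + a) c \<in> J"
        using zero_in by (rule ideal_single)
      moreover have "c \<noteq> 0" using aL vb by (simp add: c_def in_keys_iff)
      ultimately have "tmon (v + a) \<in> J" by (simp add: mult_single)
      then show ?thesis using va monomial_in_ideal_unbounded by blast
    qed (simp add: ideal_zero)
  qed
qed

end

section \<open>Localization along a face\<close>

lemma group_closure_eq_differences:
  fixes F :: "'a::ab_group_add set"
  assumes "additive_submonoid F" "x \<in> group_closure F"
  obtains a b where "a \<in> F" "b \<in> F" "x = a - b"
proof -
  have "\<exists>a\<in>F. \<exists>b\<in>F. x = a - b"
    using assms(2)
  proof induction
    case (base s)
    then show ?case using assms(1) by (intro bexI[of _ s] bexI[of _ 0]) (auto simp: additive_submonoid_def)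
  next
    case (diff s t)
    then obtain a b c d where *: "a \<in> F" "b \<in> F" "s = a - b" "c \<in> F" "d \<in> F" "t = c - d" by blast
    then have "a + d \<in> F" "b + c \<in> F" "s - t = (a + d) - (b + c)"
      using assms(1) by (auto simp: additive_submonoid_def algebra_simps)
    then show ?case by blast
  qed
  then show ?thesis using that by blast
qed

lemma subset_localize_along: "Q \<subseteq> localize_along Q F"
proof
  fix x assume "x \<in> Q"
  then have "x + 0 \<in> Q + group_closure F" by (intro set_plus_intro) auto
  then show "x \<in> localize_along Q F" by (simp add: localize_along_def)
qed

lemma group_closure_subset_localize_along:
  assumes "additive_submonoid Q" shows "group_closure F \<subseteq> localize_along Q F"
proof
  fix x assume "x \<in> group_closure F"
  then have "0 + x \<in> Q + group_closure F"
    using assms by (intro set_plus_intro) (auto simp: additive_submonoid_def)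
  then show "x \<in> localize_along Q F" by (simp add: localize_along_def)
qed

lemma additive_submonoid_localize_along:
  assumes "additive_submonoid Q" shows "additive_submonoid (localize_along Q F)"
  unfolding additive_submonoid_def
proof (intro conjI ballI)
  show "0 \<in> localize_along Q F"
    using assms subset_localize_along[of Q F] by (auto simp: additive_submonoid_def)
  fix u v assume "u \<in> localize_along Q F" "v \<in> localize_along Q F"
  then obtain a b x y where *: "a \<in> Q" "b \<in> Q" "x \<in> group_closure F" "y \<in> group_closure F"
    "u = a + x" "v = b + y"
    unfolding localize_along_def by (auto elim!: set_plus_elim)
  then have "(a + b) + (x + y) \<in> Q + group_closure F"
    using assms by (intro set_plus_intro group_closure_add) (auto simp: additive_submonoid_def)
  then show "u + v \<in> localize_along Q F" using * by (simp add: localize_along_def algebra_simps)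
qed

lemma localize_along_clear_denominator:
  assumes Q: "additive_submonoid Q" and F: "additive_submonoid F" "F \<subseteq> Q"
    and "x \<in> localize_along Q F"
  obtains a where "a \<in> F" "x + a \<in> Q"
proof -
  obtain q z where q: "q \<in> Q" "z \<in> group_closure F" "x = q + z"
    using assms(4) unfolding localize_along_def by (auto elim: set_plus_elim)
  obtain a b where ab: "a \<in> F" "b \<in> F" "z = a - b" by (rule group_closure_eq_differences[OF F(1) q(2)])
  have "x + b = q + a" using q ab by simp
  then show ?thesis using that[OF ab(2)] q ab F(2) Q by (auto simp: additive_submonoid_def)
qed

text \<open>
  The elements of \<open>\<Bbbk>[L]\<close> that some \<open>t\<^sup>a\<close> with \<open>a \<in> F\<close> multiplies into \<open>I\<close> form an ideal of \<open>\<Bbbk>[L]\<close>,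
  where \<open>L = Q + \<int>F\<close>.
\<close>

lemma ext_ideal_clear_denominator:
  fixes I :: "('a::ab_group_add \<Rightarrow>\<^sub>0 'k::field) set"
  assumes Q: "additive_submonoid Q" and F: "additive_submonoid F" "F \<subseteq> Q"
    and I: "ideal I (semigroup_algebra Q)" and f: "f \<in> ext_ideal Q F I"
  obtains a where "a \<in> F" "tmon a * f \<in> I"
proof -
  interpret I: semigroup_algebra_ideal Q I by (rule semigroup_algebra_ideal.intro[OF Q I])
  define L where "L = localize_along Q F"
  have L: "additive_submonoid L" unfolding L_def by (rule additive_submonoid_localize_along[OF Q])
  then interpret cring "semigroup_algebra L :: ('a \<Rightarrow>\<^sub>0 'k) ring" by (rule cring_semigroup_algebra)
  have FQ: "a \<in> Q" if "a \<in> F" for a using that F by blast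
  define T where "T = {f :: 'a \<Rightarrow>\<^sub>0 'k. Poly_Mapping.keys f \<subseteq> L \<and> (\<exists>a\<in>F. tmon a * f \<in> I)}"
  have "ideal T (semigroup_algebra L)"
  proof (rule ideal_semigroup_algebraI[OF L])
    show "0 \<in> T" using F I.ideal_zero by (auto simp: T_def additive_submonoid_def)
  next
    fix f g assume "f \<in> T" "g \<in> T"
    then obtain a b where ab: "a \<in> F" "b \<in> F" "tmon a * f \<in> I" "tmon b * g \<in> I" by (auto simp: T_def)
    have "tmon b * (tmon a * f) + tmon a * (tmon b * g) \<in> I"
      using ab FQ I.ideal_single[OF ab(3), of b 1] I.ideal_single[OF ab(4), of a 1] by (intro I.ideal_add) auto
    moreover have "tmon b * (tmon a * f) + tmon a * (tmon b * g) = tmon (a + b) * (f + g)"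
      by (simp add: distrib_left mult_single add.commute flip: mult.assoc)
    moreover have "a + b \<in> F" using ab F by (simp add: additive_submonoid_def)
    ultimately show "f + g \<in> T"
      using \<open>f \<in> T\<close> \<open>g \<in> T\<close> keys_add[of f g] by (auto simp: T_def)
  next
    fix u c f assume u: "u \<in> L" and f: "f \<in> T"
    then obtain a where a: "a \<in> F" "tmon a * f \<in> I" by (auto simp: T_def)
    obtain b where b: "b \<in> F" "u + b \<in> Q"
      using localize_along_clear_denominator[OF Q F] u unfolding L_def by blast
    have "Poly_Mapping.single (u + b) c * (tmon a * f) \<in> I" using a(2) b(2) by (rule I.ideal_single)
    moreover have "Poly_Mapping.single (u + b) c * (tmon a * f)
        = tmon (a + b) * (Poly_Mapping.single u c * f)"
      by (simp add: mult_single add_ac flip: mult.assoc)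
    moreover have "a + b \<in> F" using a b F by (simp add: additive_submonoid_def)
    moreover have "Poly_Mapping.keys (Poly_Mapping.single u c * f) \<subseteq> L"
      using keys_mult[of "Poly_Mapping.single u c" f] f u L
      by (fastforce simp: T_def additive_submonoid_def split: if_splits)
    ultimately show "Poly_Mapping.single u c * f \<in> T" by (auto simp: T_def)
  qed (auto simp: T_def)
  moreover have "I \<subseteq> T"
  proof
    fix f assume "f \<in> I"
    then have "Poly_Mapping.keys f \<subseteq> L" "tmon 0 * f \<in> I"
      using I.keys_subset subset_localize_along[of Q F] by (auto simp: L_def)
    moreover have "0 \<in> F" using F(1) by (simp add: additive_submonoid_def)
    ultimately show "f \<in> T" unfolding T_def by blast
  qed
  ultimately have "ext_ideal Q F I \<subseteq> T" unfolding ext_ideal_def L_def[symmetric] by (rule genideal_minimal)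
  then show ?thesis using f that by (auto simp: T_def)
qed

lemma ideal_if_binomial_ideal:
  assumes Q: "additive_submonoid Q" and "binomial_ideal Q I"
  shows "ideal I (semigroup_algebra Q)"
proof -
  interpret cring "semigroup_algebra Q :: ('a \<Rightarrow>\<^sub>0 'b) ring" by (rule cring_semigroup_algebra[OF Q])
  obtain B where B: "B \<subseteq> {tmon u - scal c (tmon v) | u v c. u \<in> Q \<and> v \<in> Q}"
    and I: "I = Idl\<^bsub>semigroup_algebra Q\<^esub> B"
    using assms(2) by (auto simp: binomial_ideal_def)
  have "B \<subseteq> carrier (semigroup_algebra Q)"
    using B keys_diff unfolding carrier_semigroup_algebra by (fastforce split: if_splits)
  then show ?thesis unfolding I by (rule genideal_ideal)
qed

text \<open>
  Binomials that generate \<open>I\<close> over \<open>\<Bbbk>[Q]\<close> also generate its extension over \<open>\<Bbbk>[Q + \<int>F]\<close>.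
\<close>

lemma binomial_ideal_ext_ideal:
  fixes I :: "('a::ab_group_add \<Rightarrow>\<^sub>0 'k::field) set"
  assumes Q: "additive_submonoid Q" and I: "binomial_ideal Q I"
  shows "binomial_ideal (localize_along Q F) (ext_ideal Q F I)"
proof -
  define L where "L = localize_along Q F"
  have L: "additive_submonoid L" unfolding L_def by (rule additive_submonoid_localize_along[OF Q])
  have QL: "Q \<subseteq> L" unfolding L_def by (rule subset_localize_along)
  interpret Q: cring "semigroup_algebra Q :: ('a \<Rightarrow>\<^sub>0 'k) ring" by (rule cring_semigroup_algebra[OF Q])
  interpret L: cring "semigroup_algebra L :: ('a \<Rightarrow>\<^sub>0 'k) ring" by (rule cring_semigroup_algebra[OF L])
  obtain B where B: "B \<subseteq> {tmon u - scal c (tmon v) | u v c. u \<in> Q \<and> v \<in> Q}"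
    and IB: "I = Idl\<^bsub>semigroup_algebra Q\<^esub> B"
    using I by (auto simp: binomial_ideal_def)
  have keysB: "Poly_Mapping.keys f \<subseteq> Q" if "f \<in> B" for f
    using B that keys_diff by (fastforce split: if_splits)
  have BL: "B \<subseteq> carrier (semigroup_algebra L)" using keysB QL by (auto simp: carrier_semigroup_algebra)
  define K where "K = Idl\<^bsub>semigroup_algebra L\<^esub> B"
  interpret K: semigroup_algebra_ideal L K
    by (intro semigroup_algebra_ideal.intro L) (auto simp: K_def intro: L.genideal_ideal[OF BL])
  have "ideal {f \<in> K. Poly_Mapping.keys f \<subseteq> Q} (semigroup_algebra Q)"
  proof (rule ideal_semigroup_algebraI[OF Q])
    fix f g assume "f \<in> {f \<in> K. Poly_Mapping.keys f \<subseteq> Q}" "g \<in> {f \<in> K. Poly_Mapping.keys f \<subseteq> Q}"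
    then show "f + g \<in> {f \<in> K. Poly_Mapping.keys f \<subseteq> Q}"
      using keys_add[of f g] by (auto intro: K.ideal_add)
  next
    fix u c f assume u: "u \<in> Q" and f: "f \<in> {f \<in> K. Poly_Mapping.keys f \<subseteq> Q}"
    have "Poly_Mapping.keys (Poly_Mapping.single u c * f) \<subseteq> Q"
      using keys_mult[of "Poly_Mapping.single u c" f] f u Q
      by (fastforce simp: additive_submonoid_def split: if_splits)
    then show "Poly_Mapping.single u c * f \<in> {f \<in> K. Poly_Mapping.keys f \<subseteq> Q}"
      using u f QL by (auto intro: K.ideal_single)
  qed (auto simp: K.ideal_zero)
  moreover have "B \<subseteq> {f \<in> K. Poly_Mapping.keys f \<subseteq> Q}"
    using L.genideal_self[OF BL] keysB by (auto simp: K_def)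
  ultimately have "I \<subseteq> K" unfolding IB using Q.genideal_minimal by blast
  then have "ext_ideal Q F I \<subseteq> K"
    unfolding ext_ideal_def L_def[symmetric] by (rule L.genideal_minimal[OF K.ideal])
  moreover have "K \<subseteq> ext_ideal Q F I"
    unfolding K_def ext_ideal_def L_def[symmetric]
  proof (rule L.genideal_minimal)
    have "B \<subseteq> I"
      unfolding IB using keysB by (intro Q.genideal_self) (auto simp: carrier_semigroup_algebra)
    have "I \<subseteq> carrier (semigroup_algebra L)" using \<open>I \<subseteq> K\<close> K.keys_subset by (auto simp: carrier_semigroup_algebra)
    then show "ideal (Idl\<^bsub>semigroup_algebra L\<^esub> I) (semigroup_algebra L)" and "B \<subseteq> Idl\<^bsub>semigroup_algebra L\<^esub> I"
      using L.genideal_ideal L.genideal_self \<open>B \<subseteq> I\<close> by blast+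
  qed
  ultimately show ?thesis unfolding binomial_ideal_def L_def[symmetric] using B QL K_def by blast
qed

section \<open>Finiteness of the cosets outside a monomial ideal\<close>

lemma additive_submonoid_of_nat_mult:
  fixes a :: "'a::comm_ring_1"
  assumes "additive_submonoid M" "a \<in> M" shows "of_nat n * a \<in> M"
  using assms by (induction n) (auto simp: additive_submonoid_def distrib_right)

lemma additive_submonoid_hull_subset: "additive_submonoid M \<Longrightarrow> A \<subseteq> M \<Longrightarrow> additive_submonoid hull A \<subseteq> M"
  by (rule hull_minimal)

lemma additive_submonoid_hull_insert:
  fixes a :: "'a::comm_ring_1"
  assumes "q \<in> additive_submonoid hull (insert a A)"
  obtains n p where "p \<in> additive_submonoid hull A" "q = of_nat n * a + p"
proof -
  define N where "N = additive_submonoid hull A"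
  have H: "0 \<in> N" "\<And>x y. \<lbrakk>x \<in> N; y \<in> N\<rbrakk> \<Longrightarrow> x + y \<in> N"
    using additive_submonoid_hull[of A] by (auto simp: N_def[symmetric] additive_submonoid_def)
  let ?M = "{of_nat n * a + p | n p. p \<in> N}"
  have "additive_submonoid ?M"
    unfolding additive_submonoid_def
  proof (intro conjI ballI)
    have "0 = of_nat 0 * a + 0" by simp
    then show "0 \<in> ?M" using H by blast
    fix x y assume "x \<in> ?M" "y \<in> ?M"
    then obtain m n p r where *: "x = of_nat m * a + p" "y = of_nat n * a + r"
      "p \<in> N" "r \<in> N" by blast
    then have "x + y = of_nat (m + n) * a + (p + r)" by (simp add: algebra_simps)
    then show "x + y \<in> ?M" using * H by blast
  qed
  moreover have "insert a A \<subseteq> ?M"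
  proof -
    have "a = of_nat 1 * a + 0" by simp
    then have "a \<in> ?M" using H by blast
    moreover have "x \<in> ?M" if "x \<in> A" for x
    proof -
      have "x = of_nat 0 * a + x" "x \<in> N" using that by (auto simp: N_def intro: hull_inc)
      then show ?thesis by blast
    qed
    ultimately show ?thesis by blast
  qed
  ultimately have "additive_submonoid hull (insert a A) \<subseteq> ?M" by (rule additive_submonoid_hull_subset)
  then show ?thesis using assms that unfolding N_def by blast
qed

text \<open>
  An element outside \<open>D\<close> is a sum of generators in which each generator not in \<open>G\<close> has bounded
  multiplicity; the generators in \<open>G\<close> do not change the coset.
\<close>

lemma finite_cosets_outside_ideal:
  fixes A :: "'a::comm_ring_1 set"
  assumes "finite A" "A \<subseteq> M" and M: "additive_submonoid M"
    and D: "\<And>u v. \<lbrakk>u \<in> D; v \<in> M\<rbrakk> \<Longrightarrow> u + v \<in> D"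
    and G: "additive_submonoid G"
    and gens: "\<And>a. a \<in> A \<Longrightarrow> a \<in> G \<or> (\<exists>n. of_nat n * a \<in> D)"
  shows "\<exists>T. finite T \<and> (\<forall>q\<in>additive_submonoid hull A. q \<in> D \<or> (\<exists>t\<in>T. \<exists>z\<in>G. q = t + z))"
  using assms(1,2) gens
proof (induction A rule: finite_induct)
  case empty
  have "additive_submonoid hull {} \<subseteq> {0 :: 'a}"
    by (rule additive_submonoid_hull_subset) (auto simp: additive_submonoid_def)
  moreover have "0 \<in> G" using G by (simp add: additive_submonoid_def)
  ultimately show ?case by (intro exI[of _ "{0}"]) auto
next
  case (insert a A)
  then obtain T where "finite T"
    and T: "\<And>q. q \<in> additive_submonoid hull A \<Longrightarrow> q \<in> D \<or> (\<exists>t\<in>T. \<exists>z\<in>G. q = t + z)" by auto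
  have aM: "of_nat n * a \<in> M" for n
    using insert.prems M by (intro additive_submonoid_of_nat_mult) auto
  have AM: "additive_submonoid hull A \<subseteq> M"
    using insert.prems by (intro additive_submonoid_hull_subset[OF M]) auto
  show ?case
  proof (cases "a \<in> G")
    case True
    have "q \<in> D \<or> (\<exists>t\<in>T. \<exists>z\<in>G. q = t + z)" if q: "q \<in> additive_submonoid hull (insert a A)" for q
    proof -
      obtain n p where np: "p \<in> additive_submonoid hull A" "q = of_nat n * a + p"
        by (rule additive_submonoid_hull_insert[OF q])
      show ?thesis
      proof (cases "p \<in> D")
        case True
        then show ?thesis using D[OF True aM[of n]] by (simp add: np add.commute)
      next
        case False
        then obtain t z where tz: "t \<in> T" "z \<in> G" "p = t + z" using T[OF np(1)] by blast
        have "of_nat n * a + z \<in> G"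
          using additive_submonoid_of_nat_mult[OF G \<open>a \<in> G\<close>] tz(2) G by (auto simp: additive_submonoid_def)
        moreover have "q = t + (of_nat n * a + z)" by (simp add: np tz algebra_simps)
        ultimately show ?thesis using tz(1) by blast
      qed
    qed
    then show ?thesis using \<open>finite T\<close> by blast
  next
    case False
    then obtain n where n: "of_nat n * a \<in> D" using insert.prems by auto
    let ?T = "(\<lambda>(m, t). of_nat m * a + t) ` ({..<n} \<times> T)"
    have "q \<in> D \<or> (\<exists>t\<in>?T. \<exists>z\<in>G. q = t + z)" if q: "q \<in> additive_submonoid hull (insert a A)" for q
    proof -
      obtain m p where mp: "p \<in> additive_submonoid hull A" "q = of_nat m * a + p"
        by (rule additive_submonoid_hull_insert[OF q])
      consider "m \<ge> n" | "p \<in> D" | "m < n" "p \<notin> D" by linarith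
      then show ?thesis
      proof cases
        case 1
        have "of_nat (m - n) * a + p \<in> M" using aM mp(1) AM M by (auto simp: additive_submonoid_def)
        then have "of_nat n * a + (of_nat (m - n) * a + p) \<in> D" by (rule D[OF n])
        then show ?thesis using 1 by (simp add: mp of_nat_diff algebra_simps)
      next
        case 2
        then show ?thesis using D[OF 2 aM[of m]] by (simp add: mp add.commute)
      next
        case 3
        then obtain t z where tz: "t \<in> T" "z \<in> G" "p = t + z" using T[OF mp(1)] by blast
        have "q = (of_nat m * a + t) + z" by (simp add: mp tz algebra_simps)
        moreover have "of_nat m * a + t \<in> ?T" using 3 tz by force
        ultimately show ?thesis using tz by blast
      qed
    qed
    then show ?thesis using \<open>finite T\<close> by (intro exI[of _ ?T]) auto
  qed
qed

section \<open>The primary component\<close>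

locale minimal_face_prime =
  fixes Q \<Phi> :: "(int ^ 'l) set" and I :: "((int ^ 'l) \<Rightarrow>\<^sub>0 'k::field) set"
  assumes affine: "affine_semigroup Q"
    and face: "semigroup_face \<Phi> Q"
    and binomial_I: "binomial_ideal Q I"
    and minimal: "minimal_prime_over (semigroup_algebra Q) I (face_ideal Q \<Phi>)"
begin

abbreviation "L \<equiv> localize_along Q \<Phi>"
abbreviation "J \<equiv> ext_ideal Q \<Phi> I"

text \<open>
  The elements that become invertible in the localization at the prime \<open>\<pp>\<^sub>\<Phi>\<close>.
\<close>

definition outside :: "((int ^ 'l) \<Rightarrow>\<^sub>0 'k) set" where
  "outside = carrier (semigroup_algebra Q) - face_ideal Q \<Phi>"

lemma submonoid_Q: "additive_submonoid Q"
  using affine additive_submonoid_hull by (auto simp: affine_semigroup_def)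

lemma submonoid_face: "additive_submonoid \<Phi>" and face_subset: "\<Phi> \<subseteq> Q"
  using face by (auto simp: semigroup_face_def)

sublocale R: cring "semigroup_algebra Q :: ((int ^ 'l) \<Rightarrow>\<^sub>0 'k) ring"
  by (rule cring_semigroup_algebra[OF submonoid_Q])

sublocale P: primeideal "face_ideal Q \<Phi>" "semigroup_algebra Q :: ((int ^ 'l) \<Rightarrow>\<^sub>0 'k) ring"
  using minimal by (simp add: minimal_prime_over_def)

sublocale I: semigroup_algebra_ideal Q I
  by (intro semigroup_algebra_ideal.intro submonoid_Q ideal_if_binomial_ideal binomial_I)

lemma outside_iff: "s \<in> outside \<longleftrightarrow> Poly_Mapping.keys s \<subseteq> Q \<and> Poly_Mapping.keys s \<inter> \<Phi> \<noteq> {}"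
  by (auto simp: outside_def carrier_semigroup_algebra face_ideal_def monomial_span_eq)

lemma outside_mult: "\<lbrakk>s \<in> outside; t \<in> outside\<rbrakk> \<Longrightarrow> s * t \<in> outside"
  using P.I_prime[of s t] R.m_closed[of s t] by (auto simp: outside_def)

lemma outside_tmon: "a \<in> \<Phi> \<Longrightarrow> tmon a \<in> outside"
  using face_subset by (auto simp: outside_iff)

lemma not_outside_if_in_I: "f \<in> I \<Longrightarrow> f \<notin> outside"
  using minimal by (auto simp: minimal_prime_over_def outside_def)

lemma clear_denominator:
  assumes "f \<in> J" obtains a where "a \<in> \<Phi>" "tmon a * f \<in> I"
  using ext_ideal_clear_denominator[OF submonoid_Q submonoid_face face_subset I.ideal assms] .

lemma submonoid_L: "additive_submonoid L"
  by (rule additive_submonoid_localize_along[OF submonoid_Q])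

sublocale lattice_binomial_ideal L J
proof (intro lattice_binomial_ideal.intro lattice_binomial_ideal_axioms.intro semigroup_algebra_ideal.intro
    binomial_semigroup_algebra_ideal.intro binomial_semigroup_algebra_ideal_axioms.intro)
  show "additive_submonoid L" by (rule submonoid_L)
  show binomial_J: "binomial_ideal L J" by (rule binomial_ideal_ext_ideal[OF submonoid_Q binomial_I])
  show "ideal J (semigroup_algebra L)" by (rule ideal_if_binomial_ideal[OF submonoid_L binomial_J])
  show "1 \<notin> J"
  proof
    assume "1 \<in> J"
    then obtain a where "a \<in> \<Phi>" "tmon a * 1 \<in> I" by (rule clear_denominator)
    then show False using not_outside_if_in_I outside_tmon by auto
  qed
qed

lemma I_subset_J: "I \<subseteq> J"
proof -
  interpret L: cring "semigroup_algebra L :: ((int ^ 'l) \<Rightarrow>\<^sub>0 'k) ring"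
    by (rule cring_semigroup_algebra[OF submonoid_L])
  have "I \<subseteq> carrier (semigroup_algebra L)"
    using I.keys_subset subset_localize_along[of Q \<Phi>] by (auto simp: carrier_semigroup_algebra)
  then show ?thesis unfolding ext_ideal_def by (rule L.genideal_self)
qed

lemma unbounded_ideal_eq: "unbounded_ideal Q \<Phi> I = Q \<inter> unbounded"
proof -
  have "face_congruence Q \<Phi> I = cong" by (simp add: face_congruence_def cong_def)
  then show ?thesis
    using subset_localize_along[of Q \<Phi>] by (auto simp: unbounded_ideal_def unbounded_def)
qed

text \<open>
  The primary component written without fractions; see \<open>primary_component_eq_component\<close>.
\<close>

definition component :: "((int ^ 'l) \<Rightarrow>\<^sub>0 'k) set" where
  "component = {f. Poly_Mapping.keys f \<subseteq> Q \<and> (\<exists>s\<in>outside. s * f \<in> I)}"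

lemma primary_component_eq_component:
  "primary_component (semigroup_algebra Q) I (face_ideal Q \<Phi>) = component"
proof -
  have "I \<subseteq> face_ideal Q \<Phi>" using minimal by (simp add: minimal_prime_over_def)
  then show ?thesis
    by (subst primary_component_eq[OF R.is_cring I.ideal P.primeideal_axioms])
      (auto simp: component_def outside_def carrier_semigroup_algebra)
qed

lemma component_add:
  assumes "f \<in> component" "g \<in> component" shows "f + g \<in> component"
proof -
  obtain s t where st: "s \<in> outside" "t \<in> outside" "s * f \<in> I" "t * g \<in> I"
    using assms by (auto simp: component_def)
  have "t * (s * f) + s * (t * g) \<in> I"
    using st I.ideal_mult[OF st(3), of t] I.ideal_mult[OF st(4), of s]
    by (intro I.ideal_add) (auto simp: outside_iff)
  moreover have "t * (s * f) + s * (t * g) = (s * t) * (f + g)" by (simp add: algebra_simps)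
  ultimately show ?thesis
    using outside_mult[OF st(1,2)] assms keys_add[of f g] by (auto simp: component_def)
qed

lemma colon_face_subset_component: "colon_face Q \<Phi> I \<subseteq> component"
proof
  fix f assume f: "f \<in> colon_face Q \<Phi> I"
  then obtain a where "a \<in> \<Phi>" "tmon a * f \<in> I" using clear_denominator by (auto simp: colon_face_def)
  then show "f \<in> component"
    using f outside_tmon by (auto simp: component_def colon_face_def carrier_semigroup_algebra)
qed

lemma common_annihilator:
  assumes "finite X" "X \<subseteq> Q - \<Phi>"
  shows "\<exists>s\<in>outside. \<forall>a\<in>X. \<exists>n. s * tmon (of_nat n * a) \<in> I"
  using assms
proof (induction X rule: finite_induct)
  case empty
  have "tmon 0 \<in> outside"
    using submonoid_face by (intro outside_tmon) (simp add: additive_submonoid_def)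
  then show ?case by blast
next
  case (insert a X)
  then obtain s where s: "s \<in> outside" "\<And>b. b \<in> X \<Longrightarrow> \<exists>n. s * tmon (of_nat n * b) \<in> I" by auto
  have pow: "tmon a ^ n = (tmon (of_nat n * a) :: (int ^ 'l) \<Rightarrow>\<^sub>0 'k)" for n
    by (induction n) (simp_all add: mult_single distrib_right)
  have "tmon a \<in> (face_ideal Q \<Phi> :: ((int ^ 'l) \<Rightarrow>\<^sub>0 'k) set)"
    using insert.prems by (simp add: face_ideal_def monomial_span_eq)
  from minimal_prime_power_annihilated[OF R.is_cring I.ideal minimal this]
  obtain t n where t: "t \<in> outside" "t * tmon (of_nat n * a) \<in> I"
    by (auto simp: pow outside_def)
  have "\<exists>n. (s * t) * tmon (of_nat n * b) \<in> I" if b: "b \<in> insert a X" for b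
  proof (cases "b = a")
    case True
    have "s * (t * tmon (of_nat n * a)) \<in> I"
      using I.ideal_mult[OF t(2)] s(1) by (auto simp: outside_iff)
    then show ?thesis by (auto simp: True mult.assoc)
  next
    case False
    then obtain m where "s * tmon (of_nat m * b) \<in> I" using s(2) b by auto
    then have "t * (s * tmon (of_nat m * b)) \<in> I"
      using I.ideal_mult t(1) by (auto simp: outside_iff)
    then show ?thesis by (auto simp: mult_ac)
  qed
  then show ?case using outside_mult[OF s(1) t(1)] by blast
qed

lemma component_if_annihilated_mod_ext_ideal:
  assumes "u \<in> Q" "s \<in> outside" "s * tmon u \<in> J" shows "tmon u \<in> component"
proof -
  obtain a where a: "a \<in> \<Phi>" "tmon a * (s * tmon u) \<in> I" using assms(3) by (rule clear_denominator)
  have "(tmon a * s) * tmon u \<in> I" using a(2) by (simp add: mult.assoc)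
  then show ?thesis
    using outside_mult[OF outside_tmon[OF a(1)] assms(2)] assms(1) by (auto simp: component_def)
qed

text \<open>
  If no \<open>v \<sim> u\<close> satisfies \<open>s t\<^sup>v \<in> J\<close> for the common multiplier \<open>s\<close>, the infinite class of \<open>u\<close> lies
  in finitely many cosets of \<open>\<int>\<Phi>\<close>. Two of its points then differ by some \<open>z \<noteq> 0\<close> in \<open>\<int>\<Phi>\<close>, so
  \<open>u \<sim> u + z\<close>, and writing \<open>z = a - b\<close> with \<open>a, b \<in> \<Phi>\<close> yields a multiplier \<open>t\<^sup>b - d t\<^sup>a\<close>.
\<close>

lemma unbounded_monomial_in_component:
  assumes u: "u \<in> Q" "u \<in> unbounded"
  shows "tmon u \<in> component"
proof -
  obtain A where A: "finite A" "Q = additive_submonoid hull A"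
    using affine by (auto simp: affine_semigroup_def)
  have AQ: "A \<subseteq> Q" unfolding A(2) by (rule hull_subset)
  obtain s where s: "s \<in> outside" "\<And>a. a \<in> A - \<Phi> \<Longrightarrow> \<exists>n. s * tmon (of_nat n * a) \<in> I"
    using common_annihilator[of "A - \<Phi>"] A(1) AQ by blast
  have QL: "Q \<subseteq> L" by (rule subset_localize_along)
  define G where "G = group_closure \<Phi>"
  have GL: "G \<subseteq> L" unfolding G_def by (rule group_closure_subset_localize_along[OF submonoid_Q])
  have G: "additive_submonoid G" by (auto simp: G_def additive_submonoid_def group_closure_add)
  have FG: "\<Phi> \<subseteq> G" by (auto simp: G_def intro: group_closure.base)
  define D where "D = {v \<in> L. s * tmon v \<in> J}"
  have D_add: "u + v \<in> D" if "u \<in> D" "v \<in> L" for u v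
  proof -
    have "tmon v * (s * tmon u) \<in> J" using that by (intro ideal_single) (auto simp: D_def)
    moreover have "tmon v * (s * tmon u) = s * tmon (u + v)" by (simp add: mult_single mult_ac add.commute)
    ultimately show ?thesis using that add_in by (auto simp: D_def)
  qed
  have gens: "a \<in> G \<or> (\<exists>n. of_nat n * a \<in> D)" if a: "a \<in> A" for a
  proof (cases "a \<in> \<Phi>")
    case False
    then obtain n where "s * tmon (of_nat n * a) \<in> I" using s(2) a by blast
    moreover have "of_nat n * a \<in> L"
      using a AQ QL by (intro additive_submonoid_of_nat_mult[OF submonoid_L]) auto
    ultimately show ?thesis using I_subset_J by (auto simp: D_def)
  qed (use FG in auto)
  obtain T where T: "finite T" "\<And>q. q \<in> Q \<Longrightarrow> q \<in> D \<or> (\<exists>t\<in>T. \<exists>z\<in>G. q = t + z)"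
    using finite_cosets_outside_ideal[OF A(1) _ submonoid_L D_add G gens] AQ QL A(2) by blast
  have TL: "\<exists>t\<in>T. \<exists>z\<in>G. v = t + z" if v: "v \<in> L" "v \<notin> D" for v
  proof -
    obtain q z where q: "q \<in> Q" "z \<in> G" "v = q + z"
      using v(1) unfolding localize_along_def G_def by (auto elim: set_plus_elim)
    then have "q \<notin> D" using D_add GL v(2) by blast
    then obtain t y where "t \<in> T" "y \<in> G" "q = t + y" using T(2) q(1) by blast
    then have "t \<in> T" "y + z \<in> G" "v = t + (y + z)"
      using q by (auto simp: G_def group_closure_add add.assoc)
    then show ?thesis by blast
  qed
  have inf: "infinite (cong `` {u})" using u by (simp add: unbounded_def)
  show ?thesis
  proof (cases "cong `` {u} \<inter> D = {}")
    case False
    then obtain v where v: "(u, v) \<in> cong" "v \<in> D" by blast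
    obtain c where c: "tmon u - Poly_Mapping.single v c \<in> J" using v(1) by (rule congE)
    have "s * (tmon u - Poly_Mapping.single v c) + Poly_Mapping.single 0 c * (s * tmon v) \<in> J"
      using s(1) QL v(2)
      by (intro ideal_add ideal_mult[OF c] ideal_single[OF _ zero_in]) (auto simp: outside_iff D_def)
    moreover have "Poly_Mapping.single 0 c * (s * tmon v) = s * Poly_Mapping.single v c"
      by (simp add: mult.left_commute mult_single)
    ultimately have "s * tmon u \<in> J" by (simp add: right_diff_distrib)
    then show ?thesis using component_if_annihilated_mod_ext_ideal u(1) s(1) by blast
  next
    case True
    have "\<forall>v\<in>cong `` {u}. \<exists>t\<in>T. \<exists>z\<in>G. v = t + z"
    proof
      fix v assume v: "v \<in> cong `` {u}"
      then have "v \<in> L" by (auto elim: congE)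
      then show "\<exists>t\<in>T. \<exists>z\<in>G. v = t + z" using v True by (intro TL) auto
    qed
    then obtain \<tau> where \<tau>: "\<And>v. v \<in> cong `` {u} \<Longrightarrow> \<tau> v \<in> T \<and> (\<exists>z\<in>G. v = \<tau> v + z)" by metis
    have "\<tau> ` (cong `` {u}) \<subseteq> T" using \<tau> by blast
    then have "finite (\<tau> ` (cong `` {u}))" using T(1) by (rule finite_subset)
    then obtain v0 where "infinite {v \<in> cong `` {u}. \<tau> v = \<tau> v0}" (is "infinite ?C")
      using pigeonhole_infinite[OF inf] by blast
    then have "?C \<noteq> {}" by (rule infinite_imp_nonempty)
    then obtain v where v: "v \<in> ?C" by (elim exE[OF ex_in_conv[THEN iffD2]])
    have "infinite (?C - {v})" using \<open>infinite ?C\<close> by simp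
    then have "?C - {v} \<noteq> {}" by (rule infinite_imp_nonempty)
    then obtain v' where v': "v' \<in> ?C - {v}" by (elim exE[OF ex_in_conv[THEN iffD2]])
    obtain y y' where y: "y \<in> G" "y' \<in> G" "v = \<tau> v0 + y" "v' = \<tau> v0 + y'"
    proof -
      have "\<exists>y\<in>G. v = \<tau> v0 + y" using \<tau>[of v] v by auto
      moreover have "\<exists>y\<in>G. v' = \<tau> v0 + y" using \<tau>[of v'] v' by auto
      ultimately show ?thesis using that by blast
    qed
    define z where "z = y' - y"
    have z: "z \<in> G" "z \<noteq> 0" "v' = v + z" using y v v' by (auto simp: z_def G_def intro: group_closure.diff)
    have "(u + z, v + z) \<in> cong" using v z(1) GL by (intro cong_add) auto
    then have "(u, u + z) \<in> cong" using v' z(3) cong_sym cong_trans by blast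
    then obtain d where d: "tmon u - Poly_Mapping.single (u + z) d \<in> J" by (rule congE)
    obtain a b where ab: "a \<in> \<Phi>" "b \<in> \<Phi>" "z = a - b"
      using group_closure_eq_differences[OF submonoid_face] z(1) unfolding G_def by blast
    have "tmon b * (tmon u - Poly_Mapping.single (u + z) d) \<in> J"
      using d ab(2) face_subset QL by (intro ideal_single) auto
    moreover have "tmon b * (tmon u - Poly_Mapping.single (u + z) d)
        = (tmon b - Poly_Mapping.single a d) * tmon u"
    proof -
      have eq: "b + (u + z) = a + u" using ab by simp
      show ?thesis unfolding left_diff_distrib right_diff_distrib mult_single eq by simp
    qed
    ultimately have "(tmon b - Poly_Mapping.single a d) * tmon u \<in> J" by simp
    moreover have "tmon b - Poly_Mapping.single a d \<in> outside"
    proof -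
      have "a \<noteq> b" using ab z(2) by auto
      then have "b \<in> Poly_Mapping.keys (tmon b - Poly_Mapping.single a d)"
        by (simp add: in_keys_iff lookup_minus lookup_single when_def)
      moreover have "Poly_Mapping.keys (tmon b - Poly_Mapping.single a d) \<subseteq> Q"
        using keys_diff[of "tmon b" "Poly_Mapping.single a d"] ab face_subset by (auto split: if_splits)
      ultimately show ?thesis using ab by (auto simp: outside_iff)
    qed
    ultimately show ?thesis using component_if_annihilated_mod_ext_ideal u(1) by blast
  qed
qed

lemma unbounded_span_subset_component: "monomial_span (unbounded_ideal Q \<Phi> I) \<subseteq> component"
proof
  fix g :: "(int ^ 'l) \<Rightarrow>\<^sub>0 'k"
  assume "g \<in> monomial_span (unbounded_ideal Q \<Phi> I)"
  then have g: "Poly_Mapping.keys g \<subseteq> Q \<inter> unbounded" by (simp add: monomial_span_eq unbounded_ideal_eq)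
  have "Poly_Mapping.single u c \<in> component" if u: "u \<in> Q \<inter> unbounded" for u c
  proof -
    obtain s where s: "s \<in> outside" "s * tmon u \<in> I"
      using unbounded_monomial_in_component[of u] u by (auto simp: component_def)
    have "Poly_Mapping.single 0 c * (s * tmon u) \<in> I" using s(2) I.zero_in by (rule I.ideal_single)
    also have "Poly_Mapping.single 0 c * (s * tmon u) = s * Poly_Mapping.single u c"
      by (simp add: mult.left_commute mult_single)
    finally show ?thesis using s(1) u by (auto simp: component_def)
  qed
  note single = this
  have zero: "0 \<in> component"
    using colon_face_subset_component ideal_zero
    by (auto simp: colon_face_def carrier_semigroup_algebra)
  have "(\<Sum>u\<in>K. Poly_Mapping.single u (Poly_Mapping.lookup g u)) \<in> component"
    if "finite K" "K \<subseteq> Q \<inter> unbounded" for K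
    using that by (induction K rule: finite_induct) (auto intro!: component_add single zero)
  from this[OF finite_keys g] show "g \<in> component" by (simp flip: poly_mapping_sum_single)
qed

text \<open>
  An element outside \<open>\<pp>\<^sub>\<Phi>\<close> contains a monomial from \<open>\<Phi>\<close>, a unit of \<open>L\<close>, so it can be cancelled from
  \<open>s f \<in> I\<close> once the monomials with infinite class are split off.
\<close>

lemma bounded_part_in_ext_ideal:
  assumes f: "f \<in> component"
  shows "f - restrict_keys unbounded f \<in> J"
proof -
  obtain s where s: "s \<in> outside" "s * f \<in> I" using f by (auto simp: component_def)
  obtain w where w: "w \<in> Poly_Mapping.keys s" "w \<in> \<Phi>" using s(1) by (auto simp: outside_iff)
  have QL: "Q \<subseteq> L" by (rule subset_localize_along)
  have sL: "Poly_Mapping.keys s \<subseteq> L" using s(1) QL by (auto simp: outside_iff)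
  have "- w \<in> group_closure \<Phi>" using w(2) by (simp add: group_closure.base)
  then have wL: "- w \<in> L" using group_closure_subset_localize_along[OF submonoid_Q] by blast
  let ?g = "restrict_keys unbounded f"
  have "Poly_Mapping.keys (s * ?g) \<subseteq> unbounded"
    using keys_mult[of s ?g] sL unbounded_add by (fastforce simp: keys_restrict_keys add.commute)
  then have g: "Poly_Mapping.keys (- (s * ?g)) \<subseteq> unbounded" by simp
  show ?thesis
  proof (rule cancel_unit_key[OF sL w(1) wL g])
    show "Poly_Mapping.keys (f - ?g) \<subseteq> L - unbounded"
      using f QL by (auto simp: component_def in_keys_iff lookup_minus lookup_restrict_keys split: if_splits)
    show "s * f \<in> J" using s(2) I_subset_J by blast
    show "s * (f - ?g) = s * f + - (s * ?g)" by (simp add: right_diff_distrib)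
  qed
qed

lemma mem_sum_iff:
  "f \<in> colon_face Q \<Phi> I <+>\<^bsub>semigroup_algebra Q\<^esub> monomial_span (unbounded_ideal Q \<Phi> I)
    \<longleftrightarrow> (\<exists>j g. j \<in> J \<and> Poly_Mapping.keys j \<subseteq> Q \<and> Poly_Mapping.keys g \<subseteq> Q \<inter> unbounded \<and> f = j + g)"
  by (auto simp: set_add_def' colon_face_def carrier_semigroup_algebra monomial_span_eq unbounded_ideal_eq)

lemma component_eq_sum:
  "component = colon_face Q \<Phi> I <+>\<^bsub>semigroup_algebra Q\<^esub> monomial_span (unbounded_ideal Q \<Phi> I)"
proof (intro equalityI subsetI)
  fix f assume f: "f \<in> component"
  let ?g = "restrict_keys unbounded f"
  have fQ: "Poly_Mapping.keys f \<subseteq> Q" using f by (simp add: component_def)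
  have "Poly_Mapping.keys ?g \<subseteq> Q \<inter> unbounded" using fQ by (auto simp: keys_restrict_keys)
  moreover have "Poly_Mapping.keys (f - ?g) \<subseteq> Q" using keys_diff[of f ?g] fQ by (auto simp: keys_restrict_keys)
  moreover have "f = (f - ?g) + ?g" by simp
  ultimately show "f \<in> colon_face Q \<Phi> I <+>\<^bsub>semigroup_algebra Q\<^esub> monomial_span (unbounded_ideal Q \<Phi> I)"
    using bounded_part_in_ext_ideal[OF f] unfolding mem_sum_iff by blast
next
  fix f assume "f \<in> colon_face Q \<Phi> I <+>\<^bsub>semigroup_algebra Q\<^esub> monomial_span (unbounded_ideal Q \<Phi> I)"
  then show "f \<in> component"
    using colon_face_subset_component unbounded_span_subset_component
    by (auto simp: set_add_def' intro!: component_add)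
qed

text \<open>
  Restricting \<open>t\<^sup>u = j + g\<close> to the finite classes removes \<open>g\<close>. If \<open>u\<close> had a finite class, this would
  put \<open>t\<^sup>u\<close> into \<open>J\<close>, although monomials in \<open>J\<close> have infinite class.
\<close>

lemma monomial_in_sum_iff:
  assumes u: "u \<in> Q"
  shows "(tmon u :: (int ^ 'l) \<Rightarrow>\<^sub>0 'k)
      \<in> colon_face Q \<Phi> I <+>\<^bsub>semigroup_algebra Q\<^esub> monomial_span (unbounded_ideal Q \<Phi> I)
    \<longleftrightarrow> u \<in> unbounded"
proof
  assume "u \<in> unbounded"
  then show "(tmon u :: (int ^ 'l) \<Rightarrow>\<^sub>0 'k)
      \<in> colon_face Q \<Phi> I <+>\<^bsub>semigroup_algebra Q\<^esub> monomial_span (unbounded_ideal Q \<Phi> I)"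
    unfolding mem_sum_iff using u ideal_zero by (intro exI[of _ 0] exI[of _ "tmon u"]) auto
next
  assume "(tmon u :: (int ^ 'l) \<Rightarrow>\<^sub>0 'k)
      \<in> colon_face Q \<Phi> I <+>\<^bsub>semigroup_algebra Q\<^esub> monomial_span (unbounded_ideal Q \<Phi> I)"
  then obtain j g where j: "j \<in> J" and g: "Poly_Mapping.keys g \<subseteq> unbounded" and eq: "tmon u = j + g"
    unfolding mem_sum_iff by blast
  show "u \<in> unbounded"
  proof (rule ccontr)
    assume "u \<notin> unbounded"
    then have "tmon u = restrict_keys (- unbounded) (j + g)"
      unfolding eq[symmetric] by (simp add: restrict_keys_single)
    also have "\<dots> = restrict_keys (- unbounded) j"
      using g restrict_keys_eq_zero[of g "- unbounded"] by (simp add: restrict_keys_add disjoint_eq_subset_Compl)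
    also have "\<dots> \<in> J" using j unbounded_cong by (intro restrict_keys_in_ideal) auto
    finally show False using monomial_in_ideal_unbounded \<open>u \<notin> unbounded\<close> by blast
  qed
qed

end

theorem theorem2p14:
  fixes Q \<Phi> :: "(int ^ 'l) set"
    and I :: "((int ^ 'l) \<Rightarrow>\<^sub>0 'k::field) set"
  assumes "affine_semigroup Q"
    and "semigroup_face \<Phi> Q"
    and "binomial_ideal Q I"
    and "minimal_prime_over (semigroup_algebra Q) I (face_ideal Q \<Phi>)"
  shows "primary_component (semigroup_algebra Q) I (face_ideal Q \<Phi>)
           = colon_face Q \<Phi> I <+>\<^bsub>semigroup_algebra Q\<^esub> monomial_span (unbounded_ideal Q \<Phi> I)
         \<and> (colon_face Q \<Phi> I <+>\<^bsub>semigroup_algebra Q\<^esub> monomial_span (unbounded_ideal Q \<Phi> I))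
             \<inter> tmon ` Q
           = tmon ` unbounded_ideal Q \<Phi> I"
proof -
  interpret minimal_face_prime Q \<Phi> I using assms by (rule minimal_face_prime.intro)
  show ?thesis
    using primary_component_eq_component component_eq_sum monomial_in_sum_iff
    by (auto simp: unbounded_ideal_eq)
qed

end
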